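(* Let $F(x):=f(x)+g(x)$ on $\mathbb{R}^n$ with $g(x):=\sum_{i=1}^n g_i(x_i)$ be closed and level-bounded, where $f:\mathbb{R}^n\to\mathbb{R}$ is a $\mathcal{C}^2$-smooth convex function with $L_f$-Lipschitz continuous gradient and each $g_i:\mathbb{R}\to\mathbb{R}\cup\{\infty\}$ is proper, closed and convex. Let $\beta\in(0,L_f^{-1})$ and, for $j=1,\dots,n$, define $\psi_j:\mathbb{R}^n\to\mathbb{R}^n$ by $$[\psi_j(x)]_i=\begin{cases}\mathrm{prox}_{\beta g_i}\big(x_i-\beta\nabla_if(x)\big), & i=j,\\ x_i,& i\ne j,\end{cases}$$ and let $H:=\psi_n\circ\cdots\circ\psi_1$. Let $x^*$ be a critical point of $F$. Suppose that $g$ admits a $\mathcal{C}^3$-active manifold $\mathcal{M}$ at $x^*$, that $f$ is $\mathcal{C}^4$-smooth near $x^*$, and that $0\in\mathrm{rint}(\partial F(x^* ))$. Then: (i) $H$ is $\mathcal{C}^2$-smooth around $x^*$, and both $H$ and $\nabla H$ are Lipschitz continuous around $x^*$. (ii) Suppose in addition that there are $\rho>0$ and $\gamma\in(0,1)$ with $\|H(x)-H(y)\|\le\gamma\|x-y\|$ for all $x,y$ in the closed ball $\mathcal{B}_{x^*}(\rho)$, and that there is a constant $M_\alpha$ such that the Anderson acceleration coefficients satisfy $\sum_{i=0}^{m_k}|\alpha^k_i|\le M_\alpha$ for all $k\in\mathbb{N}$. Then, if the initial point $x^0$ is sufficiently close to $x^*$, the iterates $\{x^k\}$ produced by Anderson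 acceleration (memory $m\ge1$) applied to $H$ from $x^0$ converge to $x^*$ R-linearly with some $\hat\gamma\in(\gamma,1)$; namely, for all $k\ge0$, $$\|H(x^k)-x^k\|\le\hat\gamma^k\|H(x^0)-x^0\|\quad\text{and}\quad\|x^k-x^*\|\le\frac{1+\gamma}{1-\gamma}\,\hat\gamma^k\|x^0-x^*\|.$$
   Context: $\|\cdot\|$ is the Euclidean norm; $\mathcal{B}_x(\rho)$ and $\hat{\mathcal{B}}_x(\rho)$ are the closed and open balls of radius $\rho$ around $x$; $\mathrm{rint}$ denotes relative interior; $\nabla_if$ is the partial derivative with respect to $x_i$; $\mathrm{prox}_{\beta\varphi}(x)=\arg\min_y\{\varphi(y)+\frac1{2\beta}\|y-x\|^2\}$. Subdifferentials. For a set $Q$ and $x\in Q$, the regular normal cone is $N_Q(x)=\{\nu:\limsup_{y\to x,\,y\in Q}\langle\nu,y-x\rangle/\|y-x\|\le0\}$; the limiting normal cone consists of all limits of $\nu_i\in N_Q(x_i)$ with $x_i\in Q$, $x_i\to x$; the Clarke normal cone $N^c_Q(x)$ is the closed convex hull of the limiting normal cone. For $\varphi$ finite at $x$, $\partial\varphi(x)=\{\nu:(\nu,-1)\in N_{\mathrm{epi}\varphi}(x,\varphi(x))\}$ (for convex $\varphi$ the usual subdifferential) and $\partial_c\varphi(x)=\{\nu:(\nu,-1)\in N^c_{\mathrm{epi}\varphi}(x,\varphi(x))\}$. A critical point of $\varphi$ is $x$ with $0\in\partial\varphi(x)$. The function $\varphi$ is regular at $x$ if $\mathrm{epi}\varphi$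 is locally closed around $(x,\varphi(x))$ and $N_{\mathrm{epi}\varphi}(x,\varphi(x))=N^c_{\mathrm{epi}\varphi}(x,\varphi(x))$. The subderivative is $d\varphi(x)(\bar\nu)=\liminf_{\tau\downarrow0,\ \nu\to\bar\nu}\frac{\varphi(x+\tau\nu)-\varphi(x)}{\tau}$. Smooth manifold. $\mathcal{M}\subset\mathbb{R}^n$ is a $\mathcal{C}^p$-smooth manifold of dimension $r$ around $\bar x\in\mathcal{M}$ if there are $\epsilon>0$ and a $\mathcal{C}^p$-smooth $G:\mathbb{R}^n\to\mathbb{R}^{n-r}$ with $\nabla G(\bar x)$ of full row rank and $\mathcal{M}\cap\hat{\mathcal{B}}_{\bar x}(\epsilon)=\{x\in\hat{\mathcal{B}}_{\bar x}(\epsilon):G(x)=0\}$. Tangent and normal spaces: $T_{\mathcal{M}}(x)=\ker\nabla G(x)$, $N_{\mathcal{M}}(x)=T_{\mathcal{M}}(x)^\perp$. Active manifold. A closed function $\varphi$ admits a $\mathcal{C}^p$-active manifold $\mathcal{M}\ni\bar x$ at $\bar x$ if: (1) near $\bar x$, $\mathcal{M}$ is a $\mathcal{C}^p$-smooth manifold and the restriction of $\varphi$ to $\mathcal{M}$ is $\mathcal{C}^p$-smooth; (2) for all $x\in\mathcal{M}$ near $\bar x$, $\varphi$ is regular at $x$ and has a subgradient there; (3) $d\varphi(\bar x)(-\nu)>-d\varphi(\bar x)(\nu)$ for all nonzero $\nu\in N_{\mathcal{M}}(\bar x)$; (4) the set-valued map $\partial_c\varphi$ is continuous at $\bar x$ relative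 to $\mathcal{M}$. Anderson acceleration with memory $m\ge1$ for a mapping $H$, started at $x^0$: put $H^k=H(x^k)$, $r^k=H^k-x^k$, $m_k=\min(m,k)$. For $k=0,1,2,\dots$ let $\alpha^k=(\alpha^k_0,\dots,\alpha^k_{m_k})$ be a minimizer of $\big\|\sum_{i=0}^{m_k}\alpha_i r^{k-m_k+i}\big\|^2$ over $\alpha\in\mathbb{R}^{m_k+1}$ with $\sum_i\alpha_i=1$, and set $x^{k+1}=\sum_{i=0}^{m_k}\alpha^k_iH^{k-m_k+i}$. "Sufficiently close" may depend on $M_\alpha$, $m$ and $H$. *)

theory Defs
  imports "HOL-Analysis.Analysis"
begin

section \<open>Smooth functions\<close>

text \<open>Meant for open sets \<open>S\<close>. On a finite-dimensional space a derivative is a continuous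
  (resp. \<open>k\<close> times continuously differentiable) function of the base point iff its value
  in every fixed direction \<open>v\<close> is, so this is the usual class of \<open>C\<close>-\<open>k\<close> functions.\<close>

primrec Ck_on :: "nat \<Rightarrow> ('a::euclidean_space \<Rightarrow> 'b::real_normed_vector) \<Rightarrow> 'a set \<Rightarrow> bool" where
  "Ck_on 0 f S \<longleftrightarrow> continuous_on S f"
| "Ck_on (Suc k) f S \<longleftrightarrow> (\<forall>x\<in>S. f differentiable (at x)) \<and>
     (\<forall>v. Ck_on k (\<lambda>x. frechet_derivative f (at x) v) S)"

definition Ck_near :: "nat \<Rightarrow> ('a::euclidean_space \<Rightarrow> 'b::real_normed_vector) \<Rightarrow> 'a \<Rightarrow> bool" where
  "Ck_near k f x \<longleftrightarrow> (\<exists>U. open U \<and> x \<in> U \<and> Ck_on k f U)"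

definition lipschitz_near :: "('a::metric_space \<Rightarrow> 'b::metric_space) \<Rightarrow> 'a \<Rightarrow> bool" where
  "lipschitz_near f x \<longleftrightarrow> (\<exists>U L. open U \<and> x \<in> U \<and> L-lipschitz_on U f)"

definition partial_deriv :: "'n \<Rightarrow> (real^'n::finite \<Rightarrow> real) \<Rightarrow> real^'n \<Rightarrow> real" where
  "partial_deriv i f x = frechet_derivative f (at x) (axis i 1)"

definition grad :: "(real^'n::finite \<Rightarrow> real) \<Rightarrow> real^'n \<Rightarrow> real^'n" where
  "grad f x = (\<chi> i. partial_deriv i f x)"


section \<open>Extended-real-valued functions\<close>

text \<open>The library's \<^const>\<open>epigraph\<close> is restricted to real-valued functions.\<close>

definition epi :: "('a \<Rightarrow> ereal) \<Rightarrow> ('a \<times> real) set" where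
  "epi \<phi> = {(x, t). \<phi> x \<le> ereal t}"

definition proper_fun :: "('a \<Rightarrow> ereal) \<Rightarrow> bool" where
  "proper_fun \<phi> \<longleftrightarrow> (\<forall>x. \<phi> x \<noteq> -\<infinity>) \<and> (\<exists>x. \<phi> x \<noteq> \<infinity>)"

definition closed_fun :: "('a::topological_space \<Rightarrow> ereal) \<Rightarrow> bool" where
  "closed_fun \<phi> \<longleftrightarrow> closed (epi \<phi>)"

definition convex_fun :: "('a::real_vector \<Rightarrow> ereal) \<Rightarrow> bool" where
  "convex_fun \<phi> \<longleftrightarrow> convex (epi \<phi>)"

definition level_bounded :: "('a::metric_space \<Rightarrow> ereal) \<Rightarrow> bool" where
  "level_bounded \<phi> \<longleftrightarrow> (\<forall>c::real. bounded {x. \<phi> x \<le> ereal c})"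

definition prox :: "real \<Rightarrow> ('a::real_normed_vector \<Rightarrow> ereal) \<Rightarrow> 'a \<Rightarrow> 'a" where
  "prox \<beta> \<phi> x = (ARG_MIN (\<lambda>y. \<phi> y + ereal (1 / (2 * \<beta>) * (norm (y - x))\<^sup>2)) y. True)"


section \<open>Normal cones and subdifferentials\<close>

text \<open>At an isolated point of \<open>Q\<close> the filter is trivial, the upper limit is \<open>-\<infinity>\<close>, and every
  vector is normal.\<close>

definition regular_normal_cone :: "'a::euclidean_space set \<Rightarrow> 'a \<Rightarrow> 'a set" where
  "regular_normal_cone Q x =
     {\<nu>. x \<in> Q \<and> Limsup (at x within Q) (\<lambda>y. ereal ((\<nu> \<bullet> (y - x)) / norm (y - x))) \<le> 0}"

definition limiting_normal_cone :: "'a::euclidean_space set \<Rightarrow> 'a \<Rightarrow> 'a set" where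
  "limiting_normal_cone Q x =
     {\<nu>. \<exists>xs \<nu>s. (\<forall>i. xs i \<in> Q \<and> \<nu>s i \<in> regular_normal_cone Q (xs i)) \<and>
           xs \<longlonglongrightarrow> x \<and> \<nu>s \<longlonglongrightarrow> \<nu>}"

definition clarke_normal_cone :: "'a::euclidean_space set \<Rightarrow> 'a \<Rightarrow> 'a set" where
  "clarke_normal_cone Q x = closure (convex hull (limiting_normal_cone Q x))"

text \<open>Both subdifferentials are empty where the function is not finite.\<close>

definition subdiff :: "('a::euclidean_space \<Rightarrow> ereal) \<Rightarrow> 'a \<Rightarrow> 'a set" where
  "subdiff \<phi> x =
     {\<nu>. \<bar>\<phi> x\<bar> \<noteq> \<infinity> \<and> (\<nu>, -1) \<in> regular_normal_cone (epi \<phi>) (x, real_of_ereal (\<phi> x))}"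

definition clarke_subdiff :: "('a::euclidean_space \<Rightarrow> ereal) \<Rightarrow> 'a \<Rightarrow> 'a set" where
  "clarke_subdiff \<phi> x =
     {\<nu>. \<bar>\<phi> x\<bar> \<noteq> \<infinity> \<and> (\<nu>, -1) \<in> clarke_normal_cone (epi \<phi>) (x, real_of_ereal (\<phi> x))}"

definition critical_point :: "('a::euclidean_space \<Rightarrow> ereal) \<Rightarrow> 'a \<Rightarrow> bool" where
  "critical_point \<phi> x \<longleftrightarrow> 0 \<in> subdiff \<phi> x"

definition regular_at :: "('a::euclidean_space \<Rightarrow> ereal) \<Rightarrow> 'a \<Rightarrow> bool" where
  "regular_at \<phi> x \<longleftrightarrow> \<bar>\<phi> x\<bar> \<noteq> \<infinity> \<and>
     (\<exists>e>0. closed (epi \<phi> \<inter> cball (x, real_of_ereal (\<phi> x)) e)) \<and>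
     regular_normal_cone (epi \<phi>) (x, real_of_ereal (\<phi> x)) =
       clarke_normal_cone (epi \<phi>) (x, real_of_ereal (\<phi> x))"

definition subderivative :: "('a::euclidean_space \<Rightarrow> ereal) \<Rightarrow> 'a \<Rightarrow> 'a \<Rightarrow> ereal" where
  "subderivative \<phi> x v =
     Liminf (at_right (0::real) \<times>\<^sub>F nhds v) (\<lambda>(\<tau>, w). (\<phi> (x + \<tau> *\<^sub>R w) - \<phi> x) / ereal \<tau>)"

text \<open>Outer and inner semicontinuity in the sense of Painleve and Kuratowski.\<close>

definition setvalued_continuous_at_rel ::
  "('a::topological_space \<Rightarrow> 'b::topological_space set) \<Rightarrow> 'a set \<Rightarrow> 'a \<Rightarrow> bool" where
  "setvalued_continuous_at_rel S X xbar \<longleftrightarrow>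
     (\<forall>xs us u. (\<forall>i. xs i \<in> X \<and> us i \<in> S (xs i)) \<and> xs \<longlonglongrightarrow> xbar \<and> us \<longlonglongrightarrow> u \<longrightarrow> u \<in> S xbar) \<and>
     (\<forall>u\<in>S xbar. \<forall>xs. (\<forall>i. xs i \<in> X) \<and> xs \<longlonglongrightarrow> xbar \<longrightarrow>
        (\<exists>us. us \<longlonglongrightarrow> u \<and> (\<forall>\<^sub>F i in sequentially. us i \<in> S (xs i))))"


section \<open>Active manifolds\<close>

text \<open>A map into a space of dimension \<open>n - r\<close>, with \<open>n = CARD('n)\<close>, is given by its component
  functions \<open>G i\<close> for \<open>i < n - r\<close>; the gradients of the components are the rows of its
  Jacobian.\<close>

definition local_equation ::
  "nat \<Rightarrow> nat \<Rightarrow> (nat \<Rightarrow> real^'n::finite \<Rightarrow> real) \<Rightarrow> (real^'n) set \<Rightarrow> real^'n \<Rightarrow> bool" where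
  "local_equation p r G M xbar \<longleftrightarrow>
     xbar \<in> M \<and> r \<le> CARD('n) \<and>
     (\<forall>i < CARD('n) - r. Ck_on p (G i) UNIV) \<and>
     dim ((\<lambda>i. grad (G i) xbar) ` {..<CARD('n) - r}) = CARD('n) - r \<and>
     (\<exists>e>0. M \<inter> ball xbar e = {x \<in> ball xbar e. \<forall>i < CARD('n) - r. G i x = 0})"

definition tangent_space ::
  "nat \<Rightarrow> (nat \<Rightarrow> real^'n::finite \<Rightarrow> real) \<Rightarrow> real^'n \<Rightarrow> (real^'n) set" where
  "tangent_space r G x = {v. \<forall>i < CARD('n) - r. grad (G i) x \<bullet> v = 0}"

definition normal_space ::
  "nat \<Rightarrow> (nat \<Rightarrow> real^'n::finite \<Rightarrow> real) \<Rightarrow> real^'n \<Rightarrow> (real^'n) set" where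
  "normal_space r G x = (tangent_space r G x)\<^sup>\<bottom>"

text \<open>The spaces above do not depend on the choice of the local equation \<open>G\<close> of \<open>M\<close>, so
  \<open>r\<close> and \<open>G\<close> may be quantified existentially. Smoothness of the restriction of \<open>\<phi>\<close> to \<open>M\<close>
  means agreement on \<open>M\<close>, near the point, with a smooth function on an open set.\<close>

definition active_manifold ::
  "nat \<Rightarrow> (real^'n::finite \<Rightarrow> ereal) \<Rightarrow> (real^'n) set \<Rightarrow> real^'n \<Rightarrow> bool" where
  "active_manifold p \<phi> M xbar \<longleftrightarrow>
     closed_fun \<phi> \<and>
     (\<exists>r G. local_equation p r G M xbar \<and>
        (\<forall>\<nu>\<in>normal_space r G xbar. \<nu> \<noteq> 0 \<longrightarrow>
           subderivative \<phi> xbar (- \<nu>) > - subderivative \<phi> xbar \<nu>)) \<and>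
     (\<exists>U h. open U \<and> xbar \<in> U \<and> Ck_on p h U \<and> (\<forall>x\<in>M \<inter> U. \<phi> x = ereal (h x))) \<and>
     (\<forall>\<^sub>F x in nhds xbar. x \<in> M \<longrightarrow> regular_at \<phi> x \<and> subdiff \<phi> x \<noteq> {}) \<and>
     setvalued_continuous_at_rel (clarke_subdiff \<phi>) M xbar"


section \<open>Coordinatewise proximal gradient map and Anderson acceleration\<close>

definition prox_coord_step ::
  "real \<Rightarrow> (real^'n::finite \<Rightarrow> real) \<Rightarrow> ('n \<Rightarrow> real \<Rightarrow> ereal) \<Rightarrow> 'n \<Rightarrow> real^'n \<Rightarrow> real^'n" where
  "prox_coord_step \<beta> f g j x =
     (\<chi> i. if i = j then prox \<beta> (g i) (x $ i - \<beta> * partial_deriv i f x) else x $ i)"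

text \<open>The linear order on the index type is the order \<open>1, \<dots>, n\<close> of the coordinates;
  \<^const>\<open>fold\<close> applies the step of the smallest index first.\<close>

definition prox_coord_sweep ::
  "real \<Rightarrow> (real^'n::{finite,linorder} \<Rightarrow> real) \<Rightarrow> ('n \<Rightarrow> real \<Rightarrow> ereal) \<Rightarrow> real^'n::{finite,linorder} \<Rightarrow> real^'n::{finite,linorder}" where
  "prox_coord_sweep \<beta> f g = fold (prox_coord_step \<beta> f g) (sorted_list_of_set UNIV)"

text \<open>Least-squares solutions need not be unique, so this is a relation between \<open>H\<close>, the memory
  \<open>m\<close>, the coefficients \<open>\<alpha> k i\<close> and the iterates \<open>x k\<close>; only \<open>\<alpha> k i\<close> with \<open>i \<le> min m k\<close> is
  relevant.\<close>

definition anderson_iteration ::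
  "('a::real_normed_vector \<Rightarrow> 'a) \<Rightarrow> nat \<Rightarrow> (nat \<Rightarrow> nat \<Rightarrow> real) \<Rightarrow> (nat \<Rightarrow> 'a) \<Rightarrow> bool" where
  "anderson_iteration H m \<alpha> x \<longleftrightarrow> (\<forall>k.
     let mk = min m k; r = (\<lambda>l. H (x l) - x l) in
       is_arg_min (\<lambda>a. (norm (\<Sum>i\<le>mk. a i *\<^sub>R r (k - mk + i)))\<^sup>2) (\<lambda>a. (\<Sum>i\<le>mk. a i) = 1) (\<alpha> k) \<and>
       x (Suc k) = (\<Sum>i\<le>mk. \<alpha> k i *\<^sub>R H (x (k - mk + i))))"

end

(* With 0 in rint of the subdifferential, -grad f(x* ) lies, coordinatewise, either in the interior
   of an interval of subgradients of g_i (a kink), where the proximal map is locally constant, or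
   is the only subgradient of g_i. Continuity of the subdifferential keeps M, near x*, inside
   x* + W with W the span of the non-kink coordinates; condition (3) says that the normal space
   meets W trivially, so M fills x* + W near x*. Restricting to coordinate lines makes g_i C^3 at
   every non-kink, where the proximal map inverts y + beta g_i'(y) and hence is C^2. For the rate,
   linearize H at x*: the residuals of Anderson acceleration satisfy
   |r_{k+1}| <= gamma |r_k| + O(max_i |r_{k-i}|^2), and the quadratic term is absorbed by
   gamma' = (1 + gamma)/2 when x^0 is close to x*. *)
theory Submission
  imports Defs
begin

subsection \<open>Calculus of \<open>C\<close>-\<open>k\<close> functions\<close>

text \<open>\<open>Ck_on\<close> differentiates in fixed directions only, which avoids
  operator-valued derivatives; the price is that the chain rule has to expand moving directions in a
  basis. The continuity condition speaks of Clarke subgradients, but regularity turns them into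
  convex subgradients at points of M near x*, and separability splits these into intervals, one per
  coordinate. The manifold is given only as a zero set; an open mapping argument takes the place of
  a chart and a dimension count. The proximal map is a choice operator, so it is controlled only at
  points y + \<beta> s with s a subgradient at y, where completing the square makes y the unique
  minimizer. In the rate estimate the memory is the obstacle: the bound for the oldest residual in
  the window exceeds that for the newest by up to \<gamma>'^(-m), and its square enters. A factor
  \<gamma>'^(2m) built into the radius of the starting ball pays for this.\<close>

lemma Ck_on_has_derivative:
  assumes "Ck_on (Suc k) f S" "x \<in> S"
  shows "(f has_derivative frechet_derivative f (at x)) (at x)"
  using assms by (simp add: frechet_derivative_works)

lemma Ck_on_frechet_derivative:
  "Ck_on (Suc k) f S \<Longrightarrow> Ck_on k (\<lambda>x. frechet_derivative f (at x) v) S"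
  by simp

lemma Ck_on_cong_imp:
  assumes "open S" "\<And>x. x \<in> S \<Longrightarrow> f x = g x" "Ck_on k f S"
  shows "Ck_on k g S"
  using assms(2,3)
proof (induction k arbitrary: f g)
  case 0
  then show ?case by (simp cong: continuous_on_cong)
next
  case (Suc k)
  have d: "(g has_derivative frechet_derivative f (at x)) (at x)" if "x \<in> S" for x
    using has_derivative_transform_within_open[OF Ck_on_has_derivative[OF Suc.prems(2) that] assms(1) that]
      Suc.prems(1) by blast
  have e: "frechet_derivative f (at x) = frechet_derivative g (at x)" if "x \<in> S" for x
    using frechet_derivative_at[OF d[OF that]] .
  have "Ck_on k (\<lambda>x. frechet_derivative g (at x) v) S" for v
    by (rule Suc.IH[of "\<lambda>x. frechet_derivative f (at x) v"]) (use Suc.prems e in auto)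
  with d show ?case by (auto simp: differentiable_def)
qed

text \<open>Derivatives at a point are unique, so an explicit formula \<open>f'\<close> may stand in
  for the choice operator \<open>frechet_derivative\<close>; openness of \<open>S\<close> lets the
  identification survive further differentiation.\<close>

lemma Ck_on_SucI:
  assumes "open S" "\<And>x. x \<in> S \<Longrightarrow> (f has_derivative f' x) (at x)"
    "\<And>v. Ck_on k (\<lambda>x. f' x v) S"
  shows "Ck_on (Suc k) f S"
proof -
  have e: "f' x = frechet_derivative f (at x)" if "x \<in> S" for x
    using frechet_derivative_at[OF assms(2)[OF that]] .
  have "Ck_on k (\<lambda>x. frechet_derivative f (at x) v) S" for v
    by (rule Ck_on_cong_imp[OF assms(1) _ assms(3)[of v]]) (simp add: e)
  with assms(2) show ?thesis by (auto simp: differentiable_def)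
qed

lemma Ck_on_subset: "Ck_on k f S \<Longrightarrow> T \<subseteq> S \<Longrightarrow> Ck_on k f T"
  by (induction k arbitrary: f) (auto intro: continuous_on_subset)

lemma Ck_on_lower: "Ck_on (Suc k) f S \<Longrightarrow> Ck_on k f S"
proof (induction k arbitrary: f)
  case 0
  then show ?case
    by (auto intro!: continuous_at_imp_continuous_on differentiable_imp_continuous_within)
next
  case (Suc k)
  have "Ck_on k (\<lambda>x. frechet_derivative f (at x) v) S" for v
    using Suc.IH Suc.prems by fastforce
  then show ?case using Suc.prems by simp
qed

lemma Ck_on_le: "k \<le> l \<Longrightarrow> Ck_on l f S \<Longrightarrow> Ck_on k f S"
  by (induction rule: inc_induct) (auto simp del: Ck_on.simps intro: Ck_on_lower)

lemma Ck_on_const: "open S \<Longrightarrow> Ck_on k (\<lambda>x. c) S"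
proof (induction k arbitrary: c)
  case (Suc k)
  show ?case
    by (rule Ck_on_SucI[where f'="\<lambda>_ _. 0"]) (use Suc in auto)
qed simp

lemma Ck_on_bounded_linear:
  assumes "bounded_linear L" "open S"
  shows "Ck_on k L S"
proof (cases k)
  case 0
  then show ?thesis using assms by (simp add: linear_continuous_on)
next
  case (Suc k')
  show ?thesis unfolding Suc
    by (rule Ck_on_SucI[where f'="\<lambda>_. L"])
      (use assms in \<open>auto intro: bounded_linear_imp_has_derivative Ck_on_const\<close>)
qed

lemma Ck_on_add:
  assumes "open S" "Ck_on k f S" "Ck_on k g S"
  shows "Ck_on k (\<lambda>x. f x + g x) S"
  using assms(2,3)
proof (induction k arbitrary: f g)
  case 0
  then show ?case by (auto intro: continuous_on_add)
next
  case (Suc k)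
  show ?case
    by (rule Ck_on_SucI[OF assms(1) has_derivative_add[OF Ck_on_has_derivative[OF Suc.prems(1)]
          Ck_on_has_derivative[OF Suc.prems(2)]]])
      (auto intro!: Suc.IH Ck_on_frechet_derivative Suc.prems simp del: Ck_on.simps)
qed

lemma Ck_on_sum:
  assumes "open S" "\<And>i. i \<in> I \<Longrightarrow> Ck_on k (f i) S"
  shows "Ck_on k (\<lambda>x. \<Sum>i\<in>I. f i x) S"
  using assms(2)
proof (induction I rule: infinite_finite_induct)
  case (insert i I)
  then show ?case by (auto intro!: Ck_on_add assms(1))
qed (auto intro: Ck_on_const assms(1))

lemma Ck_on_scaleR:
  assumes "open S" "Ck_on k u S" "Ck_on k f S"
  shows "Ck_on k (\<lambda>x. u x *\<^sub>R f x) S"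
  using assms(2,3)
proof (induction k arbitrary: u f)
  case 0
  then show ?case by (auto intro: continuous_on_scaleR)
next
  case (Suc k)
  have d: "((\<lambda>x. u x *\<^sub>R f x) has_derivative
      (\<lambda>v. u x *\<^sub>R frechet_derivative f (at x) v + frechet_derivative u (at x) v *\<^sub>R f x)) (at x)"
    if "x \<in> S" for x
    by (rule has_derivative_scaleR[OF Ck_on_has_derivative[OF Suc.prems(1) that]
          Ck_on_has_derivative[OF Suc.prems(2) that]])
  show ?case
    by (rule Ck_on_SucI[OF assms(1) d])
      (simp, intro Ck_on_add assms(1) Suc.IH Ck_on_lower[OF Suc.prems(1)]
        Ck_on_lower[OF Suc.prems(2)] Ck_on_frechet_derivative Suc.prems)
qed

lemma Ck_on_bounded_linear_compose:
  assumes "open S" "bounded_linear L" "Ck_on k f S"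
  shows "Ck_on k (\<lambda>x. L (f x)) S"
  using assms(3)
proof (induction k arbitrary: f)
  case 0
  then show ?case using assms(2) by (auto intro: bounded_linear.continuous_on)
next
  case (Suc k)
  show ?case
    by (rule Ck_on_SucI[OF assms(1) bounded_linear.has_derivative[OF assms(2) Ck_on_has_derivative]])
      (use Suc in auto)
qed

lemma Ck_on_compose:
  fixes f :: "'a::euclidean_space \<Rightarrow> 'b::real_normed_vector" and g :: "'c::euclidean_space \<Rightarrow> 'a"
  assumes "open S" "open T" "g ` S \<subseteq> T" "Ck_on k g S" "Ck_on k f T"
  shows "Ck_on k (\<lambda>x. f (g x)) S"
  using assms(4,5)
proof (induction k arbitrary: f)
  case 0
  then show ?case using assms(3) by (auto intro: continuous_on_compose2)
next
  case (Suc k)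
  let ?Df = "\<lambda>y. frechet_derivative f (at y)" and ?Dg = "\<lambda>x. frechet_derivative g (at x)"
  \<comment> \<open>The direction \<open>?Dg x v\<close> moves with \<open>x\<close>, while the
    induction hypothesis covers fixed directions only. Expanding it in the basis leaves fixed
    directions \<open>b\<close> with smooth coefficients.\<close>
  define D where "D = (\<lambda>x v. \<Sum>b\<in>Basis. (?Dg x v \<bullet> b) *\<^sub>R ?Df (g x) b)"
  have d: "((\<lambda>x. f (g x)) has_derivative D x) (at x)" if "x \<in> S" for x
  proof -
    have gx: "g x \<in> T" using that assms(3) by auto
    have df: "(f has_derivative ?Df (g x)) (at (g x))" using Ck_on_has_derivative[OF Suc.prems(2) gx] .
    have lin: "linear (?Df (g x))" using df has_derivative_linear by blast
    have "?Df (g x) w = (\<Sum>b\<in>Basis. (w \<bullet> b) *\<^sub>R ?Df (g x) b)" for w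
    proof -
      have "?Df (g x) w = ?Df (g x) (\<Sum>b\<in>Basis. (w \<bullet> b) *\<^sub>R b)"
        by (simp add: euclidean_representation)
      also have "\<dots> = (\<Sum>b\<in>Basis. (w \<bullet> b) *\<^sub>R ?Df (g x) b)"
        by (simp add: linear_sum[OF lin] linear_cmul[OF lin])
      finally show ?thesis .
    qed
    then have "D x = (\<lambda>v. ?Df (g x) (?Dg x v))"
      unfolding D_def by (intro ext) (rule sym)
    then show ?thesis
      using has_derivative_compose[OF Ck_on_has_derivative[OF Suc.prems(1) that] df] by simp
  qed
  have g: "Ck_on k g S" "Ck_on k (\<lambda>x. ?Dg x v) S" for v
    using Ck_on_lower[OF Suc.prems(1)] Ck_on_frechet_derivative[OF Suc.prems(1)] by auto
  have f: "Ck_on k (\<lambda>x. ?Df x v) T" for v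
    using Suc.prems by auto
  show ?case
  proof (rule Ck_on_SucI[OF assms(1) d])
    fix v
    show "Ck_on k (\<lambda>x. D x v) S" unfolding D_def
      by (intro Ck_on_sum Ck_on_scaleR assms(1) Suc.IH[OF g(1) f]
          Ck_on_bounded_linear_compose[OF assms(1) bounded_linear_inner_left g(2)])
  qed
qed

text \<open>Bootstrapping: the derivative is a product of \<open>inverse (u x)\<close> with
  derivatives of \<open>u\<close>, so order \<open>k\<close> of these factors gives order
  \<open>k + 1\<close> of the reciprocal.\<close>

lemma Ck_on_inverse:
  fixes u :: "'a::euclidean_space \<Rightarrow> real"
  assumes "open S" "Ck_on k u S" "\<And>x. x \<in> S \<Longrightarrow> u x \<noteq> 0"
  shows "Ck_on k (\<lambda>x. inverse (u x)) S"
  using assms(2)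
proof (induction k)
  case 0
  then show ?case using assms(3) by (auto intro: continuous_on_inverse)
next
  case (Suc k)
  let ?Du = "\<lambda>x. frechet_derivative u (at x)"
  have u: "Ck_on k u S" "Ck_on k (\<lambda>x. ?Du x v) S" for v
    using Ck_on_lower[OF Suc.prems] Ck_on_frechet_derivative[OF Suc.prems] by auto
  have d: "((\<lambda>x. inverse (u x)) has_derivative
      (\<lambda>v. (- 1) *\<^sub>R (inverse (u x) *\<^sub>R (inverse (u x) *\<^sub>R ?Du x v)))) (at x)" if "x \<in> S" for x
    using Deriv.has_derivative_inverse[OF assms(3)[OF that] Ck_on_has_derivative[OF Suc.prems that]]
    by (simp add: mult_ac)
  show ?case
    by (rule Ck_on_SucI[OF assms(1) d])
      (assumption, intro Ck_on_scaleR Ck_on_const assms(1) Suc.IH u)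
qed

lemma Ck_on_vec:
  fixes f :: "'n::finite \<Rightarrow> 'a::euclidean_space \<Rightarrow> real"
  assumes "open S" "\<And>i. Ck_on k (f i) S"
  shows "Ck_on k (\<lambda>x. \<chi> i. f i x) S"
proof -
  have "(\<lambda>x. \<chi> i. f i x) = (\<lambda>x. \<Sum>i\<in>UNIV. f i x *\<^sub>R axis i 1)"
    by (simp add: fun_eq_iff vec_eq_iff axis_def if_distrib cong: if_cong)
  then show ?thesis using assms by (auto intro!: Ck_on_sum Ck_on_scaleR Ck_on_const)
qed

text \<open>In one dimension a continuous injective map is open, so a given left inverse is the
  inverse on an open set. Its derivative is the reciprocal of a function of \<open>\<theta>\<close>
  itself, which raises the order step by step. The left inverse is a parameter because the proximal
  map takes its place.\<close>

lemma Ck_on_local_inverse: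
  fixes \<phi> \<theta> :: "real \<Rightarrow> real"
  assumes "open S" "Ck_on k \<phi> S" "\<And>y. y \<in> S \<Longrightarrow> \<theta> (\<phi> y) = y"
    "\<And>y. y \<in> S \<Longrightarrow> frechet_derivative \<phi> (at y) 1 \<noteq> 0" "k \<ge> 1"
  shows "open (\<phi> ` S) \<and> Ck_on k \<theta> (\<phi> ` S)"
proof -
  obtain k' where k: "k = Suc k'" using assms(5) by (cases k) auto
  let ?D = "\<lambda>y. frechet_derivative \<phi> (at y) 1"
  have inj: "inj_on \<phi> S" using assms(3) by (metis inj_onI)
  have cont: "continuous_on S \<phi>"
    using Ck_on_le[OF _ assms(2), of 0] by simp
  have o: "open (\<phi> ` S)"
    by (rule injective_into_1d_imp_open_map_UNIV[OF assms(1) cont inj]) simp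
  have d\<phi>: "(\<phi> has_derivative (\<lambda>v. v * ?D y)) (at y)" if "y \<in> S" for y
  proof -
    have d: "(\<phi> has_derivative frechet_derivative \<phi> (at y)) (at y)"
      using Ck_on_has_derivative assms(2) that k by blast
    have "frechet_derivative \<phi> (at y) v = v * ?D y" for v
      using linear_cmul[OF has_derivative_linear[OF d], of v 1] by simp
    then have "frechet_derivative \<phi> (at y) = (\<lambda>v. v * ?D y)" by blast
    with d show ?thesis by simp
  qed
  have d\<theta>: "(\<theta> has_derivative (\<lambda>v. inverse (?D (\<theta> z)) *\<^sub>R v)) (at z)" if zS: "z \<in> \<phi> ` S" for z
  proof -
    obtain y where y: "y \<in> S" "z = \<phi> y" using zS by blast
    show ?thesis
      unfolding y(2) assms(3)[OF y(1)]
      by (rule has_derivative_inverse_strong[OF assms(1) y(1) cont assms(3) d\<phi>[OF y(1)]])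
        (use assms(4)[OF y(1)] in \<open>auto simp: fun_eq_iff\<close>)
  qed
  have "Ck_on j \<theta> (\<phi> ` S)" if "j \<le> k" for j
    using that
  proof (induction j)
    case 0
    show ?case using has_derivative_continuous[OF d\<theta>]
      by (auto intro!: continuous_at_imp_continuous_on simp del: real_scaleR_def)
  next
    case (Suc j)
    have \<theta>: "Ck_on j \<theta> (\<phi> ` S)" using Suc by simp
    have "Ck_on j ?D S" using assms(2) Suc.prems k by (auto intro: Ck_on_le)
    then have "Ck_on j (\<lambda>z. ?D (\<theta> z)) (\<phi> ` S)"
      by (intro Ck_on_compose[OF o assms(1) _ \<theta>]) (auto simp: assms(3))
    then have "Ck_on j (\<lambda>z. inverse (?D (\<theta> z))) (\<phi> ` S)"
      by (rule Ck_on_inverse[OF o]) (auto simp: assms(3,4))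
    then show ?case
      by (intro Ck_on_SucI[OF o d\<theta>] Ck_on_scaleR o Ck_on_const)
  qed
  with o show ?thesis by simp
qed

section \<open>Smoothness near a point\<close>

lemma Ck_near_compose:
  fixes f :: "'a::euclidean_space \<Rightarrow> 'b::real_normed_vector" and g :: "'c::euclidean_space \<Rightarrow> 'a"
  assumes "Ck_near k g x" "Ck_near k f (g x)"
  shows "Ck_near k (\<lambda>x. f (g x)) x"
proof -
  obtain U where U: "open U" "x \<in> U" "Ck_on k g U" using assms(1) by (auto simp: Ck_near_def)
  obtain V where V: "open V" "g x \<in> V" "Ck_on k f V" using assms(2) by (auto simp: Ck_near_def)
  define W where "W = U \<inter> g -` V"
  have "continuous_on U g" using Ck_on_le[OF _ U(3), of 0] by simp
  then have W: "open W" using U(1) V(1)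
    unfolding W_def by (metis continuous_open_preimage)
  have "Ck_on k (\<lambda>x. f (g x)) W"
    by (rule Ck_on_compose[OF W V(1) _ Ck_on_subset[OF U(3)] V(3)]) (auto simp: W_def)
  then show ?thesis using W U(2) V(2) unfolding Ck_near_def W_def by blast
qed

lemma Ck_near_cong:
  assumes "Ck_near k f x" "\<forall>\<^sub>F y in nhds x. f y = g y"
  shows "Ck_near k g x"
proof -
  obtain U where U: "open U" "x \<in> U" "Ck_on k f U" using assms(1) by (auto simp: Ck_near_def)
  obtain V where V: "open V" "x \<in> V" "\<And>y. y \<in> V \<Longrightarrow> f y = g y"
    using assms(2) by (auto simp: eventually_nhds)
  have "Ck_on k g (U \<inter> V)"
    by (rule Ck_on_cong_imp[of _ f]) (use U V in \<open>auto intro: Ck_on_subset\<close>)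
  then show ?thesis unfolding Ck_near_def using U V by blast
qed

lemma Ck_near_vec:
  fixes f :: "'n::finite \<Rightarrow> 'a::euclidean_space \<Rightarrow> real"
  assumes "\<And>i. Ck_near k (f i) x"
  shows "Ck_near k (\<lambda>x. \<chi> i. f i x) x"
proof -
  obtain U where U: "\<And>i. open (U i) \<and> x \<in> U i \<and> Ck_on k (f i) (U i)"
    using assms unfolding Ck_near_def by metis
  have o: "open (\<Inter>i. U i)" using U by auto
  have "Ck_on k (f i) (\<Inter>i. U i)" for i
    by (rule Ck_on_subset[of _ _ "U i"]) (use U in auto)
  then show ?thesis using Ck_on_vec[OF o] U o unfolding Ck_near_def by blast
qed

section \<open>Mean value estimates from derivatives in basis directions\<close>

lemma norm_linear_le_sum_Basis:
  fixes D :: "'a::euclidean_space \<Rightarrow> 'b::real_normed_vector"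
  assumes "linear D"
  shows "norm (D v) \<le> (\<Sum>b\<in>Basis. norm (D b)) * norm v"
proof -
  have "D v = D (\<Sum>b\<in>Basis. (v \<bullet> b) *\<^sub>R b)" by (simp add: euclidean_representation)
  also have "\<dots> = (\<Sum>b\<in>Basis. (v \<bullet> b) *\<^sub>R D b)"
    by (simp add: linear_sum[OF assms] linear_cmul[OF assms])
  finally have "norm (D v) \<le> (\<Sum>b\<in>Basis. norm ((v \<bullet> b) *\<^sub>R D b))"
    by (simp only: norm_sum)
  also have "\<dots> \<le> (\<Sum>b\<in>Basis. norm (D b) * norm v)"
    by (intro sum_mono) (simp add: Basis_le_norm mult.commute[of "norm v"] mult_left_mono mult.commute[of "\<bar>v \<bullet> _\<bar>"])
  finally show ?thesis by (simp add: sum_distrib_right)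
qed

text \<open>The partial derivatives are bounded on a compact ball; finitely many of them bound the
  operator norm, and the mean value inequality on the ball does the rest.\<close>

lemma Ck_on_1_lipschitz_near:
  assumes "Ck_on (Suc 0) f U" "open U" "x \<in> U"
  shows "lipschitz_near f x"
proof -
  let ?D = "\<lambda>x. frechet_derivative f (at x)"
  obtain e where e: "e > 0" "cball x e \<subseteq> U" using assms open_contains_cball by blast
  have "\<exists>B. \<forall>y\<in>cball x e. norm (?D y b) \<le> B" for b
  proof -
    have "continuous_on (cball x e) (\<lambda>y. ?D y b)"
      using assms(1) e(2) by (auto intro: continuous_on_subset)
    then have "compact ((\<lambda>y. ?D y b) ` cball x e)" by (intro compact_continuous_image) auto
    then show ?thesis by (auto dest!: compact_imp_bounded simp: bounded_iff)
  qed
  then obtain B where B: "\<And>b y. y \<in> cball x e \<Longrightarrow> norm (?D y b) \<le> B b" by metis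
  have d: "(f has_derivative ?D y) (at y)" if "y \<in> cball x e" for y
    using Ck_on_has_derivative[OF assms(1)] that e(2) by blast
  define L where "L = (\<Sum>b\<in>Basis. \<bar>B b\<bar>)"
  have L0: "L \<ge> 0" by (simp add: L_def sum_nonneg)
  have on: "onorm (?D y) \<le> L" if "y \<in> cball x e" for y
  proof (rule onorm_bound[OF L0])
    fix v
    have "norm (?D y v) \<le> (\<Sum>b\<in>Basis. norm (?D y b)) * norm v"
      by (rule norm_linear_le_sum_Basis[OF has_derivative_linear[OF d[OF that]]])
    also have "\<dots> \<le> L * norm v"
      unfolding L_def by (intro mult_right_mono sum_mono order.trans[OF B[OF that]]) auto
    finally show "norm (?D y v) \<le> L * norm v" .
  qed
  have "L-lipschitz_on (ball x e) f"
  proof (rule lipschitz_onI[OF _ L0])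
    fix y z assume yz: "y \<in> ball x e" "z \<in> ball x e"
    have "norm (f y - f z) \<le> L * norm (y - z)"
      by (rule differentiable_bound[of "cball x e" f ?D])
        (use yz in \<open>auto intro!: has_derivative_at_withinI[OF d] on\<close>)
    then show "dist (f y) (f z) \<le> L * dist y z" by (simp add: dist_norm)
  qed
  then show ?thesis unfolding lipschitz_near_def using e(1) by (intro exI[of _ "ball x e"]) auto
qed

lemma Ck_on_2_derivative_lipschitz:
  assumes "Ck_on 2 f U" "open U" "x \<in> U"
  shows "\<exists>e>0. \<exists>L\<ge>0. ball x e \<subseteq> U \<and> (\<forall>b\<in>Basis.
    L-lipschitz_on (ball x e) (\<lambda>y. frechet_derivative f (at y) b))"
proof -
  let ?D = "\<lambda>x. frechet_derivative f (at x)"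
  have "lipschitz_near (\<lambda>y. ?D y b) x" for b
    using assms by (intro Ck_on_1_lipschitz_near) (auto simp: numeral_2_eq_2 simp del: One_nat_def)
  then have "\<exists>e L. e > 0 \<and> L-lipschitz_on (ball x e) (\<lambda>y. ?D y b)" for b
    unfolding lipschitz_near_def by (meson open_contains_ball lipschitz_on_subset)
  then obtain e L where eL: "\<And>b. e b > 0" "\<And>b. (L b)-lipschitz_on (ball x (e b)) (\<lambda>y. ?D y b)"
    by metis
  obtain e0 where e0: "e0 > 0" "ball x e0 \<subseteq> U" using assms open_contains_ball by blast
  define d where "d = Min (insert e0 (e ` Basis))"
  define K where "K = Max (insert 0 (L ` Basis))"
  have "d > 0" using eL e0 by (simp add: d_def)
  moreover have "K-lipschitz_on (ball x d) (\<lambda>y. ?D y b)" if "b \<in> Basis" for b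
  proof -
    have "L b \<le> K" "d \<le> e b" using that by (auto simp: K_def d_def intro: Max_ge Min_le simp del: Max_insert Min_insert)
    then have "(L b)-lipschitz_on (ball x d) (\<lambda>y. ?D y b)"
      by (intro lipschitz_on_subset[OF eL(2)[of b]]) auto
    then show ?thesis using \<open>L b \<le> K\<close> by (rule lipschitz_on_le)
  qed
  moreover have "K \<ge> 0" "d \<le> e0" by (auto simp: K_def d_def)
  ultimately show ?thesis using e0(2) by (intro exI[of _ d] exI[of _ K] conjI) (auto simp: K_def)
qed

lemma Ck_on_2_quadratic_error:
  assumes "Ck_on 2 f U" "open U" "x \<in> U"
  shows "\<exists>e>0. \<exists>K\<ge>0. \<forall>y\<in>ball x e.
    norm (f y - f x - frechet_derivative f (at x) (y - x)) \<le> K * (norm (y - x))\<^sup>2"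
proof -
  let ?D = "\<lambda>x. frechet_derivative f (at x)"
  obtain e L where e: "e > 0" "L \<ge> 0" "ball x e \<subseteq> U"
    and L: "\<And>b. b \<in> Basis \<Longrightarrow> L-lipschitz_on (ball x e) (\<lambda>y. ?D y b)"
    using Ck_on_2_derivative_lipschitz[OF assms] by metis
  have d: "(f has_derivative ?D y) (at y)" if "y \<in> ball x e" for y
    using Ck_on_has_derivative[of 1 f U] assms(1) that e(3) by (auto simp: numeral_2_eq_2)
  define K where "K = real DIM('a) * L"
  have K0: "K \<ge> 0" using e by (simp add: K_def)
  have xin: "x \<in> ball x e" using e by simp
  have "norm (f y - f x - ?D x (y - x)) \<le> K * (norm (y - x))\<^sup>2" if y: "y \<in> ball x e" for y
  proof -
    \<comment> \<open>The mean value inequality is applied to \<open>f\<close> minus its linear part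
      on points no farther from \<open>x\<close> than \<open>y\<close>: there the derivative is at
      most \<open>K * norm (y - x)\<close>, and the length of the segment contributes the second
      factor.\<close>
    let ?S = "ball x e \<inter> cball x (dist x y)"
    have der: "((\<lambda>z. f z - ?D x z) has_derivative (\<lambda>v. ?D z v - ?D x v)) (at z within ?S)"
      if "z \<in> ?S" for z
    proof -
      have "(f has_derivative ?D z) (at z within ?S)"
        by (rule has_derivative_at_withinI[OF d]) (use that in simp)
      moreover have "(?D x has_derivative ?D x) (at z within ?S)"
        by (rule bounded_linear_imp_has_derivative[OF has_derivative_bounded_linear[OF d[OF xin]]])
      ultimately show ?thesis by (rule has_derivative_diff)
    qed
    have on: "onorm (\<lambda>v. ?D z v - ?D x v) \<le> K * norm (y - x)" if z: "z \<in> ?S" for z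
    proof (rule onorm_bound)
      fix v
      have lin: "linear (\<lambda>v. ?D z v - ?D x v)"
        by (rule linear_compose_sub[OF has_derivative_linear[OF d] has_derivative_linear[OF d[OF xin]]])
          (use z in simp)
      have "norm (?D z v - ?D x v) \<le> (\<Sum>b\<in>Basis. norm (?D z b - ?D x b)) * norm v"
        using norm_linear_le_sum_Basis[OF lin, of v] .
      also have "(\<Sum>b\<in>Basis. norm (?D z b - ?D x b)) \<le> (\<Sum>b\<in>(Basis::'a set). L * norm (y - x))"
      proof (rule sum_mono)
        fix b :: 'a assume "b \<in> Basis"
        from lipschitz_onD[OF L[OF this], of z x] z xin
        have "norm (?D z b - ?D x b) \<le> L * dist z x" by (simp add: dist_norm)
        also have "\<dots> \<le> L * norm (y - x)" using z e(2)
          by (intro mult_left_mono) (auto simp: dist_commute dist_norm norm_minus_commute)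
        finally show "norm (?D z b - ?D x b) \<le> L * norm (y - x)" .
      qed
      finally show "norm (?D z v - ?D x v) \<le> K * norm (y - x) * norm v"
        by (simp add: K_def mult_ac mult_right_mono)
    qed (use K0 in auto)
    have "norm ((f y - ?D x y) - (f x - ?D x x)) \<le> K * norm (y - x) * norm (y - x)"
      by (rule differentiable_bound[OF _ der on]) (use y xin in \<open>auto intro!: convex_Int\<close>)
    moreover have "(f y - ?D x y) - (f x - ?D x x) = f y - f x - ?D x (y - x)"
      using linear_diff[OF has_derivative_linear[OF d[OF xin]], of y x] by simp
    ultimately show ?thesis by (simp add: power2_eq_square)
  qed
  with e(1) K0 show ?thesis by blast
qed

text \<open>The matrix norm is dominated by the sum of the absolute entries, and each entry is a
  coordinate of a derivative in a basis direction.\<close>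

lemma Ck_on_2_jacobian_lipschitz_near:
  fixes f :: "real^'n::finite \<Rightarrow> real^'m::finite"
  assumes "Ck_on 2 f U" "open U" "x \<in> U"
  shows "lipschitz_near (\<lambda>x. jacobian f (at x)) x"
proof -
  let ?D = "\<lambda>x. frechet_derivative f (at x)"
  obtain e L where e: "e > 0" "L \<ge> 0"
    and L: "\<And>b. b \<in> Basis \<Longrightarrow> L-lipschitz_on (ball x e) (\<lambda>y. ?D y b)"
    using Ck_on_2_derivative_lipschitz[OF assms] by metis
  define K where "K = (\<Sum>i\<in>(UNIV::'m set). \<Sum>j\<in>(UNIV::'n set). L)"
  have "K-lipschitz_on (ball x e) (\<lambda>x. jacobian f (at x))"
  proof (rule lipschitz_onI)
    fix y z assume yz: "y \<in> ball x e" "z \<in> ball x e"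
    let ?J = "jacobian f (at y) - jacobian f (at z)"
    have ent: "\<bar>?J $ i $ j\<bar> \<le> L * dist y z" for i j
    proof -
      have "\<bar>?J $ i $ j\<bar> = \<bar>(?D y (axis j 1) - ?D z (axis j 1)) $ i\<bar>"
        by (simp add: jacobian_def matrix_def)
      also have "\<dots> \<le> norm (?D y (axis j 1) - ?D z (axis j 1))" by (rule component_le_norm_cart)
      also have "\<dots> \<le> L * dist y z"
        using lipschitz_onD[OF L[of "axis j 1"] yz] by (simp add: dist_norm axis_in_Basis_iff)
      finally show ?thesis .
    qed
    have "norm ?J \<le> (\<Sum>i\<in>UNIV. norm (?J $ i))" unfolding norm_vec_def by (rule L2_set_le_sum) simp
    also have "\<dots> \<le> (\<Sum>i\<in>UNIV. \<Sum>j\<in>UNIV. \<bar>?J $ i $ j\<bar>)" by (intro sum_mono norm_le_l1_cart)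
    also have "\<dots> \<le> (\<Sum>i\<in>(UNIV::'m set). \<Sum>j\<in>(UNIV::'n set). L * dist y z)"
      by (intro sum_mono ent)
    finally show "dist (jacobian f (at y)) (jacobian f (at z)) \<le> K * dist y z"
      by (simp add: K_def dist_norm sum_distrib_right)
  qed (use e in \<open>simp add: K_def\<close>)
  then show ?thesis unfolding lipschitz_near_def using e(1) by (intro exI[of _ "ball x e"]) auto
qed

subsection \<open>Subgradients of convex functions\<close>

text \<open>The subdifferential of convex analysis, by global affine minorants. Inequalities at
  single points can be read off from it directly; \<open>subdiff_convex\<close> links it to the
  normal-cone version.\<close>

definition subgradients :: "('a::real_inner \<Rightarrow> ereal) \<Rightarrow> 'a \<Rightarrow> 'a set" where
  "subgradients \<phi> x = {s. \<bar>\<phi> x\<bar> \<noteq> \<infinity> \<and> (\<forall>y. \<phi> x + ereal (s \<bullet> (y - x)) \<le> \<phi> y)}"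

lemma subgradientsI:
  assumes "\<phi> x = ereal a" "\<And>y. ereal (a + s \<bullet> (y - x)) \<le> \<phi> y"
  shows "s \<in> subgradients \<phi> x"
  using assms by (simp add: subgradients_def)

lemma subgradientsD:
  assumes "s \<in> subgradients \<phi> x" "\<phi> x = ereal a"
  shows "ereal (a + s \<bullet> (y - x)) \<le> \<phi> y"
  using assms by (simp add: subgradients_def)

lemma subgradients_finite:
  assumes "s \<in> subgradients \<phi> x"
  shows "\<phi> x = ereal (real_of_ereal (\<phi> x))"
  using assms by (simp add: subgradients_def ereal_real)

lemma subgradients_abs: "s \<in> subgradients \<phi> x \<Longrightarrow> \<bar>\<phi> x\<bar> \<noteq> \<infinity>"
  by (simp add: subgradients_def)

lemma convex_subgradients: "convex (subgradients \<phi> x)"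
proof (rule convexI)
  fix s t u v assume st: "s \<in> subgradients \<phi> x" "t \<in> subgradients \<phi> x"
    and uv: "0 \<le> u" "0 \<le> v" "u + v = (1::real)"
  define a where "a = real_of_ereal (\<phi> x)"
  have a: "\<phi> x = ereal a" using subgradients_finite[OF st(1)] by (simp add: a_def)
  show "u *\<^sub>R s + v *\<^sub>R t \<in> subgradients \<phi> x"
  proof (rule subgradientsI[where \<phi>=\<phi> and x=x, OF a])
    fix y
    have v: "v = 1 - u" using uv by simp
    show "ereal (a + (u *\<^sub>R s + v *\<^sub>R t) \<bullet> (y - x)) \<le> \<phi> y"
    \<comment> \<open>It suffices to compare with the real upper bounds of \<open>\<phi> y\<close>,
      which disposes of infinite values.\<close>
    proof (rule ereal_le_real)
      fix b assume "\<phi> y \<le> ereal b"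
      then have "a + s \<bullet> (y - x) \<le> b" "a + t \<bullet> (y - x) \<le> b"
        using subgradientsD[OF st(1) a, of y] subgradientsD[OF st(2) a, of y]
        by (metis ereal_less_eq(3) order.trans)+
      then have "u * (a + s \<bullet> (y - x)) + v * (a + t \<bullet> (y - x)) \<le> b"
        using uv by (intro convex_bound_le)
      then show "ereal (a + (u *\<^sub>R s + v *\<^sub>R t) \<bullet> (y - x)) \<le> ereal b"
        unfolding v by (simp add: algebra_simps)
    qed
  qed
qed

lemma subgradients_real_monotone:
  fixes \<phi> :: "real \<Rightarrow> ereal"
  assumes "s \<in> subgradients \<phi> x" "t \<in> subgradients \<phi> y"
  shows "(s - t) * (x - y) \<ge> 0"
proof -
  obtain a b where ab: "\<phi> x = ereal a" "\<phi> y = ereal b" using assms subgradients_finite by blast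
  have "a + s * (y - x) \<le> b" "b + t * (x - y) \<le> a"
    using subgradientsD[OF assms(1) ab(1), of y] subgradientsD[OF assms(2) ab(2), of x] ab
    by simp_all
  then show ?thesis by (simp add: algebra_simps)
qed

text \<open>Points of the segment from \<open>x\<close> to \<open>y\<close> give the same quotient
  as \<open>y\<close> itself, however close to \<open>x\<close> they are; a positive quotient would
  make the upper limit positive.\<close>

lemma regular_normal_cone_convex:
  assumes "convex Q" "x \<in> Q"
  shows "regular_normal_cone Q x = {\<nu>. \<forall>y\<in>Q. \<nu> \<bullet> (y - x) \<le> 0}"
proof (intro set_eqI iffI; clarsimp)
  fix \<nu> y assume \<nu>: "\<nu> \<in> regular_normal_cone Q x" and y: "y \<in> Q"
  show "\<nu> \<bullet> (y - x) \<le> 0"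
  proof (rule ccontr)
    assume *: "\<not> \<nu> \<bullet> (y - x) \<le> 0"
    define c where "c = \<nu> \<bullet> (y - x) / norm (y - x)"
    have yx: "y \<noteq> x" using * by auto
    have c: "c > 0" using * yx by (simp add: c_def)
    have "Limsup (at x within Q) (\<lambda>y. ereal ((\<nu> \<bullet> (y - x)) / norm (y - x))) < ereal c"
      using \<nu> c unfolding regular_normal_cone_def
      by (metis (mono_tags, lifting) CollectD ereal_less(2) order.strict_trans1)
    from Limsup_lessD[OF this] obtain d where d: "d > 0"
      "\<And>z. z \<in> Q \<Longrightarrow> z \<noteq> x \<Longrightarrow> dist z x < d \<Longrightarrow> (\<nu> \<bullet> (z - x)) / norm (z - x) < c"
      by (auto simp: eventually_at)
    \<comment> \<open>The minimum with 1 keeps the point on the segment, the other term brings it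
      within \<open>d\<close> of \<open>x\<close>.\<close>
    define t where "t = min 1 (d / (2 * norm (y - x)))"
    have t: "t > 0" "t \<le> 1" using d yx by (auto simp: t_def)
    have tn: "t * norm (y - x) < d"
    proof -
      have "t * norm (y - x) \<le> d / (2 * norm (y - x)) * norm (y - x)"
        by (intro mult_right_mono) (auto simp: t_def)
      then show ?thesis using yx d by simp
    qed
    let ?z = "(1 - t) *\<^sub>R x + t *\<^sub>R y"
    have z: "?z \<in> Q" using convexD[OF assms(1,2) y, of "1 - t" t] t by simp
    have zx: "?z - x = t *\<^sub>R (y - x)" by (simp add: algebra_simps)
    have "?z \<noteq> x" using zx t yx by auto
    then have "(\<nu> \<bullet> (?z - x)) / norm (?z - x) < c"
      using d(2)[OF z] tn t by (simp add: dist_norm zx)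
    then show False using t by (simp add: zx c_def)
  qed
next
  fix \<nu> assume *: "\<forall>y\<in>Q. \<nu> \<bullet> (y - x) \<le> 0"
  have "\<forall>\<^sub>F y in at x within Q. ereal ((\<nu> \<bullet> (y - x)) / norm (y - x)) \<le> 0"
    unfolding eventually_at by (rule exI[of _ 1]) (use * in \<open>auto simp: divide_nonpos_nonneg\<close>)
  then show "\<nu> \<in> regular_normal_cone Q x"
    using assms(2) by (auto simp: regular_normal_cone_def intro: Limsup_bounded)
qed

text \<open>Normals to the convex epigraph satisfy a global inequality, and pairing
  \<open>(\<nu>, -1)\<close> with \<open>(y, b) - (x, a)\<close> turns it into the subgradient
  inequality at height \<open>b\<close>.\<close>

lemma subdiff_convex:
  assumes "convex_fun \<phi>"
  shows "subdiff \<phi> x = subgradients \<phi> x"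
proof (cases "\<bar>\<phi> x\<bar> = \<infinity>")
  case True
  then show ?thesis by (auto simp: subdiff_def subgradients_def)
next
  case False
  then obtain a where a: "\<phi> x = ereal a" by (cases "\<phi> x") auto
  have "(\<nu>, -1) \<in> regular_normal_cone (epi \<phi>) (x, a) \<longleftrightarrow> \<nu> \<in> subgradients \<phi> x" for \<nu>
  proof -
    have "(\<nu>, -1) \<in> regular_normal_cone (epi \<phi>) (x, a) \<longleftrightarrow>
        (\<forall>y b. \<phi> y \<le> ereal b \<longrightarrow> a + \<nu> \<bullet> (y - x) \<le> b)"
    proof -
      have "convex (epi \<phi>)" "(x, a) \<in> epi \<phi>" using assms a by (auto simp: convex_fun_def epi_def)
      from regular_normal_cone_convex[OF this]
      have "(\<nu>, -1) \<in> regular_normal_cone (epi \<phi>) (x, a) \<longleftrightarrow>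
          (\<forall>y b. (y, b) \<in> epi \<phi> \<longrightarrow> (\<nu>, -1) \<bullet> ((y, b) - (x, a)) \<le> 0)" by auto
      moreover have "(\<nu>, -1) \<bullet> ((y, b) - (x, a)) \<le> 0 \<longleftrightarrow> a + \<nu> \<bullet> (y - x) \<le> b" for y b
        by (auto simp: inner_Pair)
      ultimately show ?thesis by (simp only: epi_def mem_Collect_eq prod.case)
    qed
    also have "\<dots> \<longleftrightarrow> (\<forall>y. ereal (a + \<nu> \<bullet> (y - x)) \<le> \<phi> y)" (is "?L \<longleftrightarrow> ?R")
    proof
      assume L: ?L
      show ?R
      proof (rule allI, rule ereal_le_real)
        fix y b assume "\<phi> y \<le> ereal b"
        then show "ereal (a + \<nu> \<bullet> (y - x)) \<le> ereal b"
          unfolding ereal_less_eq by (rule L[rule_format])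
      qed
    next
      assume R: ?R
      show ?L
      proof (intro allI impI)
        fix y b assume "\<phi> y \<le> ereal b"
        then have "ereal (a + \<nu> \<bullet> (y - x)) \<le> ereal b" by (rule order.trans[OF R[rule_format]])
        then show "a + \<nu> \<bullet> (y - x) \<le> b" by simp
      qed
    qed
    also have "\<dots> \<longleftrightarrow> \<nu> \<in> subgradients \<phi> x" using a by (simp add: subgradients_def)
    finally show ?thesis .
  qed
  then show ?thesis using a by (simp add: subdiff_def)
qed

section \<open>Convexity and first-order minorants\<close>

lemma convex_funD:
  assumes "convex_fun \<phi>" "\<phi> x \<le> ereal a" "\<phi> y \<le> ereal b" "0 \<le> t" "t \<le> 1"
  shows "\<phi> (x + t *\<^sub>R (y - x)) \<le> ereal (a + t * (b - a))"
proof -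
  have "(1 - t) *\<^sub>R (x, a) + t *\<^sub>R (y, b) \<in> epi \<phi>"
    using assms by (intro convexD) (auto simp: convex_fun_def epi_def)
  then show ?thesis by (simp add: epi_def algebra_simps)
qed

lemma convex_fun_of_convex_on: "convex_on UNIV f \<Longrightarrow> convex_fun (\<lambda>x. ereal (f x))"
  unfolding convex_fun_def
proof (rule convexI; clarsimp simp: epi_def)
  fix x y :: 'a and a b u v :: real
  assume f: "convex_on UNIV f" and ab: "f x \<le> a" "f y \<le> b" and uv: "0 \<le> u" "0 \<le> v" "u + v = 1"
  have "f (u *\<^sub>R x + v *\<^sub>R y) \<le> u * f x + v * f y"
    using f uv by (simp add: convex_on_def)
  also have "\<dots> \<le> u * a + v * b" using ab uv by (intro add_mono mult_left_mono)
  finally show "f (u *\<^sub>R x + v *\<^sub>R y) \<le> u * a + v * b" .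
qed

lemma convex_fun_add:
  assumes "convex_fun \<phi>" "convex_fun \<kappa>" "\<And>x. \<phi> x \<noteq> -\<infinity>" "\<And>x. \<kappa> x \<noteq> -\<infinity>"
  shows "convex_fun (\<lambda>x. \<phi> x + \<kappa> x)"
  unfolding convex_fun_def
proof (rule convexI; clarsimp simp: epi_def)
  fix x y :: 'a and a b u v :: real
  assume a: "\<phi> x + \<kappa> x \<le> ereal a" and b: "\<phi> y + \<kappa> y \<le> ereal b" and uv: "0 \<le> u" "0 \<le> v" "u + v = 1"
  have u: "u = 1 - v" using uv(3) by simp
  have z: "u *\<^sub>R x + v *\<^sub>R y = x + v *\<^sub>R (y - x)" by (simp add: u algebra_simps)
  obtain a1 a2 where a12: "\<phi> x = ereal a1" "\<kappa> x = ereal a2"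
    using a assms(3,4)[of x] by (cases "\<phi> x"; cases "\<kappa> x") auto
  obtain b1 b2 where b12: "\<phi> y = ereal b1" "\<kappa> y = ereal b2"
    using b assms(3,4)[of y] by (cases "\<phi> y"; cases "\<kappa> y") auto
  have "\<phi> (x + v *\<^sub>R (y - x)) \<le> ereal (a1 + v * (b1 - a1))"
    "\<kappa> (x + v *\<^sub>R (y - x)) \<le> ereal (a2 + v * (b2 - a2))"
    using uv by (auto intro!: convex_funD assms simp: a12 b12)
  from add_mono[OF this] have "\<phi> (x + v *\<^sub>R (y - x)) + \<kappa> (x + v *\<^sub>R (y - x)) \<le>
      ereal (u * (a1 + a2) + v * (b1 + b2))"
    by (simp add: u algebra_simps)
  also have "\<dots> \<le> ereal (u * a + v * b)"
    using a b a12 b12 uv by (auto intro!: add_mono mult_left_mono)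
  finally show "\<phi> (u *\<^sub>R x + v *\<^sub>R y) + \<kappa> (u *\<^sub>R x + v *\<^sub>R y) \<le> ereal (u * a + v * b)"
    unfolding z .
qed

lemma tendsto_directional_derivative:
  fixes h :: "'a::real_normed_vector \<Rightarrow> real"
  assumes "(h has_derivative h') (at x)"
  shows "((\<lambda>t. (h (x + t *\<^sub>R d) - h x) / t) \<longlongrightarrow> h' d) (at_right 0)"
proof -
  have "((\<lambda>t. x + t *\<^sub>R d) has_derivative (\<lambda>t. t *\<^sub>R d)) (at 0)"
    by (auto intro!: derivative_eq_intros)
  then have "((\<lambda>t. h (x + t *\<^sub>R d)) has_derivative (\<lambda>t. h' (t *\<^sub>R d))) (at 0)"
    by (rule has_derivative_compose) (simp add: assms)
  moreover have "(\<lambda>t. h' (t *\<^sub>R d)) = (*) (h' d)"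
    using linear_cmul[OF has_derivative_linear[OF assms]] by (auto simp: mult.commute)
  ultimately have "((\<lambda>t. h (x + t *\<^sub>R d)) has_real_derivative h' d) (at 0)"
    by (simp add: has_field_derivative_def)
  then have "((\<lambda>t. (h (x + t *\<^sub>R d) - h x) / t) \<longlongrightarrow> h' d) (at 0)"
    by (simp add: DERIV_def)
  then show ?thesis by (rule tendsto_mono[rotated]) (rule at_le, simp)
qed

text \<open>A first-order lower bound near \<open>x\<close> becomes global: along the segment to
  \<open>z\<close> convexity caps the difference quotient by \<open>b - a\<close> for every real
  \<open>b\<close> above \<open>\<phi> z\<close>, hence also caps the limit \<open>c\<close> of its
  lower bounds.\<close>

lemma convex_fun_directional_bound:
  assumes "convex_fun \<phi>" "\<phi> x = ereal a" "(q \<longlongrightarrow> c) (at_right 0)"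
    "\<forall>\<^sub>F t in at_right 0. ereal (a + t * q t) \<le> \<phi> (x + t *\<^sub>R (z - x))"
  shows "ereal (a + c) \<le> \<phi> z"
proof (rule ereal_le_real)
  fix b assume b: "\<phi> z \<le> ereal b"
  have "\<forall>\<^sub>F t in at_right 0. 0 < t \<and> t < (1::real)"
    by (auto simp: eventually_at_right_field intro!: exI[of _ 1])
  with assms(4) have "\<forall>\<^sub>F t in at_right 0. q t \<le> b - a"
  proof eventually_elim
    case (elim t)
    have "ereal (a + t * q t) \<le> ereal (a + t * (b - a))"
      using elim convex_funD[OF assms(1) _ b, of x a t] assms(2) by (metis less_imp_le order.refl order.trans)
    then show ?case using elim by simp
  qed
  from tendsto_upperbound[OF assms(3) this] show "ereal (a + c) \<le> ereal b" by simp
qed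

lemma convex_fun_derivative_bound:
  assumes "convex_fun \<phi>" "\<forall>\<^sub>F y in nhds x. \<phi> y = ereal (h y)" "(h has_derivative h') (at x)"
  shows "ereal (h x + h' (z - x)) \<le> \<phi> z"
proof (rule convex_fun_directional_bound[OF assms(1) _ tendsto_directional_derivative[OF assms(3)]])
  show "\<phi> x = ereal (h x)" using eventually_nhds_x_imp_x[OF assms(2)] .
  have "((\<lambda>t. x + t *\<^sub>R (z - x)) \<longlongrightarrow> x + 0 *\<^sub>R (z - x)) (at_right 0)"
    by (intro tendsto_intros)
  then have "filterlim (\<lambda>t. x + t *\<^sub>R (z - x)) (nhds x) (at_right 0)" by simp
  from eventually_compose_filterlim[OF assms(2) this] eventually_at_right_less[of 0]
  show "\<forall>\<^sub>F t in at_right 0. ereal (h x + t * ((h (x + t *\<^sub>R (z - x)) - h x) / t)) \<le> \<phi> (x + t *\<^sub>R (z - x))"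
    by eventually_elim simp
qed

text \<open>One direction moves the difference quotient of \<open>f\<close> to the other side and
  passes to its limit, after which convexity of \<open>g\<close> globalizes the bound; the other
  adds the affine minorants of \<open>f\<close> and \<open>g\<close>.\<close>

lemma subgradients_add_smooth:
  fixes f :: "'a::real_inner \<Rightarrow> real"
  assumes "convex_on UNIV f" "(f has_derivative (\<lambda>v. d \<bullet> v)) (at x)" "convex_fun g"
  shows "s \<in> subgradients (\<lambda>x. ereal (f x) + g x) x \<longleftrightarrow> s - d \<in> subgradients g x"
proof
  assume s: "s \<in> subgradients (\<lambda>x. ereal (f x) + g x) x"
  then obtain a where a: "g x = ereal a"
    by (cases "g x") (auto simp: subgradients_def)
  show "s - d \<in> subgradients g x"
  proof (rule subgradientsI[where \<phi>=g and x=x, OF a])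
    fix z
    have "((\<lambda>t. s \<bullet> (z - x) - (f (x + t *\<^sub>R (z - x)) - f x) / t) \<longlongrightarrow> s \<bullet> (z - x) - d \<bullet> (z - x)) (at_right 0)"
      by (intro tendsto_intros tendsto_directional_derivative[OF assms(2)])
    then have "ereal (a + (s \<bullet> (z - x) - d \<bullet> (z - x))) \<le> g z"
    proof (rule convex_fun_directional_bound[OF assms(3) a])
      show "\<forall>\<^sub>F t in at_right 0. ereal (a + t * (s \<bullet> (z - x) - (f (x + t *\<^sub>R (z - x)) - f x) / t)) \<le> g (x + t *\<^sub>R (z - x))"
        using eventually_at_right_less[of 0]
      proof eventually_elim
        case (elim t)
        have "ereal (f x + a + s \<bullet> (t *\<^sub>R (z - x))) \<le> ereal (f (x + t *\<^sub>R (z - x))) + g (x + t *\<^sub>R (z - x))"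
          using subgradientsD[OF s, of "f x + a" "x + t *\<^sub>R (z - x)"] a by simp
        moreover have "t * (s \<bullet> (z - x) - (f (x + t *\<^sub>R (z - x)) - f x) / t) =
            s \<bullet> (t *\<^sub>R (z - x)) - (f (x + t *\<^sub>R (z - x)) - f x)"
          using elim by (simp only: right_diff_distrib) simp
        ultimately show ?case
          by (cases "g (x + t *\<^sub>R (z - x))") auto
      qed
    qed
    then show "ereal (a + (s - d) \<bullet> (z - x)) \<le> g z" by (simp add: inner_diff_left)
  qed
next
  assume s: "s - d \<in> subgradients g x"
  then obtain a where a: "g x = ereal a" using subgradients_finite by blast
  show "s \<in> subgradients (\<lambda>x. ereal (f x) + g x) x"
  proof (rule subgradientsI)
    show "ereal (f x) + g x = ereal (f x + a)" using a by simp
    fix z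
    have "ereal (f x + d \<bullet> (z - x)) \<le> ereal (f z)"
      by (rule convex_fun_derivative_bound[OF convex_fun_of_convex_on[OF assms(1)] _ assms(2)]) simp
    moreover have "ereal (a + (s - d) \<bullet> (z - x)) \<le> g z" by (rule subgradientsD[OF s a])
    ultimately have "ereal (f x + d \<bullet> (z - x)) + ereal (a + (s - d) \<bullet> (z - x)) \<le> ereal (f z) + g z"
      by (rule add_mono)
    then show "ereal (f x + a + s \<bullet> (z - x)) \<le> ereal (f z) + g z"
      by (simp add: algebra_simps)
  qed
qed

subsection \<open>Separable functions\<close>

lemma sum_ereal_split:
  fixes gs :: "'n::finite \<Rightarrow> real \<Rightarrow> ereal"
  shows "(\<Sum>j\<in>UNIV. gs j ((x + (t - x $ i) *\<^sub>R axis i 1) $ j)) = gs i t + (\<Sum>j\<in>UNIV - {i}. gs j (x $ j))"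
proof -
  have "(\<Sum>j\<in>UNIV. gs j ((x + (t - x $ i) *\<^sub>R axis i 1) $ j)) =
      gs i t + (\<Sum>j\<in>UNIV - {i}. gs j ((x + (t - x $ i) *\<^sub>R axis i 1) $ j))"
    by (subst sum.remove[of _ i]) (auto simp: axis_def)
  also have "(\<Sum>j\<in>UNIV - {i}. gs j ((x + (t - x $ i) *\<^sub>R axis i 1) $ j)) = (\<Sum>j\<in>UNIV - {i}. gs j (x $ j))"
    by (rule sum.cong) (auto simp: axis_def)
  finally show ?thesis .
qed

lemma sum_ereal_not_MInf:
  fixes c :: "'i \<Rightarrow> ereal"
  shows "(\<And>i. i \<in> I \<Longrightarrow> c i \<noteq> -\<infinity>) \<Longrightarrow> (\<Sum>i\<in>I. c i) \<noteq> -\<infinity>"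
  by (induction I rule: infinite_finite_induct) auto

lemma sum_ereal_finite_iff:
  fixes c :: "'i \<Rightarrow> ereal"
  assumes "finite I" "\<And>i. i \<in> I \<Longrightarrow> c i \<noteq> -\<infinity>"
  shows "\<bar>\<Sum>i\<in>I. c i\<bar> \<noteq> \<infinity> \<longleftrightarrow> (\<forall>i\<in>I. \<bar>c i\<bar> \<noteq> \<infinity>)"
  using assms by (auto simp: sum_Inf abs_eq_infinity_cases)

text \<open>Testing on coordinate lines isolates one summand, because the others are finite
  constants and cancel; conversely the inequalities are summed over the coordinates.\<close>

lemma subgradients_separable:
  fixes gs :: "'n::finite \<Rightarrow> real \<Rightarrow> ereal" and x s :: "real^'n"
  assumes "\<And>i t. gs i t \<noteq> -\<infinity>"
  shows "s \<in> subgradients (\<lambda>x. \<Sum>i\<in>UNIV. gs i (x $ i)) x \<longleftrightarrow>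
    (\<forall>i. s $ i \<in> subgradients (gs i) (x $ i))"
proof (cases "\<forall>i. \<bar>gs i (x $ i)\<bar> \<noteq> \<infinity>")
  case False
  then have "\<bar>\<Sum>i\<in>UNIV. gs i (x $ i)\<bar> = \<infinity>"
    using sum_ereal_finite_iff[of UNIV "\<lambda>i. gs i (x $ i)", OF finite assms] by (metis UNIV_I)
  then have "s \<notin> subgradients (\<lambda>x. \<Sum>i\<in>UNIV. gs i (x $ i)) x"
    using subgradients_abs by metis
  moreover have "\<not> (\<forall>i. s $ i \<in> subgradients (gs i) (x $ i))"
    using False subgradients_abs by metis
  ultimately show ?thesis by blast
next
  case True
  define c where "c i = real_of_ereal (gs i (x $ i))" for i
  have c: "gs i (x $ i) = ereal (c i)" for i using True by (simp add: c_def ereal_real)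
  have sc: "(\<Sum>i\<in>J. gs i (x $ i)) = ereal (\<Sum>i\<in>J. c i)" for J by (simp add: c)
  show ?thesis
  proof
    assume s: "s \<in> subgradients (\<lambda>x. \<Sum>i\<in>UNIV. gs i (x $ i)) x"
    show "\<forall>i. s $ i \<in> subgradients (gs i) (x $ i)"
    proof
      fix i
      show "s $ i \<in> subgradients (gs i) (x $ i)"
      proof (rule subgradientsI[where \<phi>="gs i" and x="x $ i", OF c])
        fix t
        have "ereal ((\<Sum>i\<in>UNIV. c i) + s \<bullet> ((t - x $ i) *\<^sub>R axis i 1)) \<le> gs i t + (\<Sum>j\<in>UNIV - {i}. gs j (x $ j))"
          using subgradientsD[OF s sc, of "x + (t - x $ i) *\<^sub>R axis i 1"] by (simp only: sum_ereal_split add_diff_cancel_left')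
        moreover have "(\<Sum>i\<in>UNIV. c i) = c i + (\<Sum>j\<in>UNIV - {i}. c j)" by (simp add: sum.remove)
        ultimately show "ereal (c i + s $ i \<bullet> (t - x $ i)) \<le> gs i t"
          by (cases "gs i t") (auto simp: sc inner_axis mult.commute)
      qed
    qed
  next
    assume s: "\<forall>i. s $ i \<in> subgradients (gs i) (x $ i)"
    show "s \<in> subgradients (\<lambda>x. \<Sum>i\<in>UNIV. gs i (x $ i)) x"
    proof (rule subgradientsI[where \<phi>="\<lambda>x. \<Sum>i\<in>UNIV. gs i (x $ i)" and x=x, OF sc])
      fix y
      have "(\<Sum>i\<in>UNIV. ereal (c i + s $ i \<bullet> (y $ i - x $ i))) \<le> (\<Sum>i\<in>UNIV. gs i (y $ i))"
        using s by (intro sum_mono) (rule subgradientsD[where \<phi>="gs _" and x="x $ _", OF _ c], simp)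
      then show "ereal (sum c UNIV + s \<bullet> (y - x)) \<le> (\<Sum>i\<in>UNIV. gs i (y $ i))"
        by (simp add: inner_vec_def sum.distrib)
    qed
  qed
qed

lemma convex_fun_separable:
  fixes gs :: "'n::finite \<Rightarrow> real \<Rightarrow> ereal"
  assumes "\<And>i. convex_fun (gs i)" "\<And>i t. gs i t \<noteq> -\<infinity>"
  shows "convex_fun (\<lambda>x::real^'n. \<Sum>i\<in>UNIV. gs i (x $ i))"
proof -
  have single: "convex_fun (\<lambda>x::real^'n. gs i (x $ i))" for i
    unfolding convex_fun_def
  proof (rule convexI; clarsimp simp: epi_def)
    fix x y :: "real^'n" and a b u v :: real
    assume *: "gs i (x $ i) \<le> ereal a" "gs i (y $ i) \<le> ereal b" "0 \<le> u" "0 \<le> v" "u + v = 1"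
    then have u: "u = 1 - v" by simp
    have "gs i (x $ i + v *\<^sub>R (y $ i - x $ i)) \<le> ereal (a + v * (b - a))"
      using * by (intro convex_funD assms(1)) auto
    moreover have "x $ i + v *\<^sub>R (y $ i - x $ i) = u * x $ i + v * y $ i" "a + v * (b - a) = u * a + v * b"
      by (simp_all add: u algebra_simps)
    ultimately show "gs i (u * x $ i + v * y $ i) \<le> ereal (u * a + v * b)" by simp
  qed
  have "convex_fun (\<lambda>x::real^'n. \<Sum>i\<in>I. gs i (x $ i))" if "finite I" for I
    using that
  proof (induction I rule: finite_induct)
    case empty
    then show ?case using convex_fun_of_convex_on[of "\<lambda>_. 0"] by (simp add: convex_on_const zero_ereal_def)
  next
    case (insert i I)
    have "convex_fun (\<lambda>x::real^'n. gs i (x $ i) + (\<Sum>i\<in>I. gs i (x $ i)))"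
      using insert assms(2) by (intro convex_fun_add single insert.IH) (auto simp: sum_ereal_not_MInf)
    then show ?case using insert by simp
  qed
  then show ?thesis by simp
qed

subsection \<open>Subderivatives\<close>

text \<open>The lower limit runs over all directions near \<open>v\<close>, and \<open>v\<close>
  itself belongs to every such neighbourhood; the fixed direction therefore already bounds it from
  above.\<close>

lemma subderivative_le:
  assumes "\<phi> x = ereal a" "\<forall>\<^sub>F t in at_right 0. \<phi> (x + t *\<^sub>R v) \<le> ereal (a + t * c)"
  shows "subderivative \<phi> x v \<le> ereal c"
proof (rule ccontr)
  assume "\<not> subderivative \<phi> x v \<le> ereal c"
  then have "ereal c < subderivative \<phi> x v" by simp
  from less_LiminfD[OF this[unfolded subderivative_def]]
  obtain P Q where PQ: "eventually P (at_right 0)" "eventually Q (nhds v)"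
    "\<And>t w. P t \<Longrightarrow> Q w \<Longrightarrow> ereal c < (\<phi> (x + t *\<^sub>R w) - \<phi> x) / ereal t"
    by (auto simp: eventually_prod_filter)
  have "Q v" using eventually_nhds_x_imp_x[OF PQ(2)] .
  have "\<forall>\<^sub>F t in at_right (0::real). False"
    using assms(2) PQ(1) eventually_at_right_less[of 0]
  proof eventually_elim
    case (elim t)
    have "\<phi> (x + t *\<^sub>R v) - \<phi> x \<le> ereal (t * c)"
      using elim(1) assms(1) by (cases "\<phi> (x + t *\<^sub>R v)") auto
    then have "(\<phi> (x + t *\<^sub>R v) - \<phi> x) / ereal t \<le> ereal (t * c) / ereal t"
      using elim by (intro ereal_divide_right_mono) auto
    then show False using PQ(3)[OF elim(2) \<open>Q v\<close>] elim by simp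
  qed
  then show False by simp
qed

text \<open>A single subgradient means differentiability: neither \<open>s + \<epsilon>\<close> nor
  \<open>s - \<epsilon>\<close> is a subgradient, and on the segment from \<open>x\<close> to a
  point violating such a minorant convexity keeps \<open>\<phi>\<close> below it.\<close>

lemma unique_subgradient_upper_bound:
  fixes \<phi> :: "real \<Rightarrow> ereal"
  assumes "convex_fun \<phi>" "\<phi> x = ereal a" "subgradients \<phi> x = {s}" "\<epsilon> > 0"
  shows "\<forall>\<^sub>F t in nhds x. \<phi> t \<le> ereal (a + s * (t - x) + \<epsilon> * \<bar>t - x\<bar>)"
proof -
  have s: "ereal (a + s * (y - x)) \<le> \<phi> y" for y
    using subgradientsD[where \<phi>=\<phi> and x=x, OF _ assms(2), of s y] assms(3) by simp
  \<comment> \<open>As \<open>s\<close> is a subgradient, slope \<open>s + e\<close> can be violated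
    only where \<open>e * (y - x) > 0\<close>; the two signs of \<open>e\<close> thus yield one
    point on each side of \<open>x\<close>.\<close>
  have ex: "\<exists>y b. y \<noteq> x \<and> \<phi> y \<le> ereal b \<and> b < a + (s + e) * (y - x) \<and> e * (y - x) > 0" if "e \<noteq> 0" for e
  proof -
    have "s + e \<notin> subgradients \<phi> x" using assms(3) that by simp
    then obtain y where y: "\<phi> y < ereal (a + (s + e) * (y - x))"
      by (metis subgradientsI[where \<phi>=\<phi> and x=x, OF assms(2)] not_le inner_real_def)
    obtain b where b: "\<phi> y = ereal b" using y s[of y] by (cases "\<phi> y") auto
    then show ?thesis using y s[of y] by (intro exI[of _ y] exI[of _ b]) (auto simp: algebra_simps)
  qed
  have bd: "\<phi> t \<le> ereal (a + (s + e) * (t - x))"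
    if "\<phi> y \<le> ereal b" "b < a + (s + e) * (y - x)" "0 \<le> (t - x) / (y - x)" "(t - x) / (y - x) \<le> 1" "y \<noteq> x" for e y b t
  proof -
    let ?\<tau> = "(t - x) / (y - x)"
    have "\<phi> (x + ?\<tau> *\<^sub>R (y - x)) \<le> ereal (a + ?\<tau> * (b - a))"
      using that assms(2) by (intro convex_funD[OF assms(1)]) auto
    moreover have "?\<tau> *\<^sub>R (y - x) = t - x" using that(5) by simp
    moreover have "?\<tau> * (b - a) \<le> ?\<tau> * ((s + e) * (y - x))" using that by (intro mult_left_mono) auto
    moreover have "?\<tau> * ((s + e) * (y - x)) = (s + e) * (t - x)" using that(5) by simp
    ultimately show ?thesis by (smt (verit) ereal_less_eq(3) order.trans add.commute diff_add_cancel)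
  qed
  obtain y1 b1 where 1: "\<phi> y1 \<le> ereal b1" "b1 < a + (s + \<epsilon>) * (y1 - x)" "y1 > x"
    using ex[of \<epsilon>] assms(4) by (auto simp: zero_less_mult_iff)
  obtain y2 b2 where 2: "\<phi> y2 \<le> ereal b2" "b2 < a + (s + - \<epsilon>) * (y2 - x)" "y2 < x"
    using ex[of "- \<epsilon>"] assms(4) by (auto simp: zero_less_mult_iff mult_less_0_iff)
  have "\<phi> t \<le> ereal (a + s * (t - x) + \<epsilon> * \<bar>t - x\<bar>)" if t: "t \<in> {y2<..<y1}" for t
  proof (cases "t \<ge> x")
    case True
    have "\<phi> t \<le> ereal (a + (s + \<epsilon>) * (t - x))"
      using True 1 t by (intro bd[OF 1(1,2)]) (auto simp: divide_simps)
    then show ?thesis using True by (simp add: algebra_simps)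
  next
    case False
    have "\<phi> t \<le> ereal (a + (s + - \<epsilon>) * (t - x))"
      using False 2 t by (intro bd[OF 2(1,2)]) (auto simp: divide_simps)
    then show ?thesis using False by (simp add: algebra_simps)
  qed
  moreover have "\<forall>\<^sub>F t in nhds x. t \<in> {y2<..<y1}"
    using 1 2 by (intro eventually_nhds_in_open) auto
  ultimately show ?thesis by (rule eventually_mono[rotated])
qed

subsection \<open>Identification of the active manifold\<close>

lemma frechet_derivative_eq_grad:
  fixes f :: "real^'n::finite \<Rightarrow> real"
  assumes "f differentiable (at x)"
  shows "frechet_derivative f (at x) v = grad f x \<bullet> v"
proof -
  have lin: "linear (frechet_derivative f (at x))"
    using assms by (simp add: linear_frechet_derivative)
  have "frechet_derivative f (at x) v = frechet_derivative f (at x) (\<Sum>i\<in>UNIV. v $ i *\<^sub>R axis i 1)"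
    using basis_expansion[of v] by (simp add: scalar_mult_eq_scaleR)
  also have "\<dots> = grad f x \<bullet> v"
    by (simp add: linear_sum[OF lin] linear_cmul[OF lin] grad_def partial_deriv_def inner_vec_def mult.commute)
  finally show ?thesis .
qed

text \<open>Full rank makes the \<open>b i\<close> distinct and independent, so some linear
  functional is 1 at \<open>b j\<close> and 0 at the others. Projecting the vector that represents
  it onto the span keeps these values and makes it a combination of the \<open>b i\<close>.\<close>

lemma dual_basis_exists:
  fixes b :: "nat \<Rightarrow> 'a::euclidean_space"
  assumes "dim (b ` {..<k}) = k"
  shows "\<exists>c. \<forall>j<k. c j \<in> span (b ` {..<k}) \<and> (\<forall>i<k. b i \<bullet> c j = (if i = j then 1 else 0))"
proof -
  let ?S = "b ` {..<k}"
  have "card ?S = k"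
    using assms dim_le_card'[of ?S] card_image_le[of "{..<k}" b] by simp
  then have inj: "inj_on b {..<k}" by (simp add: eq_card_imp_inj_on)
  have ind: "independent ?S"
    by (rule card_le_dim_spanning[of _ "span ?S"]) (use \<open>card ?S = k\<close> assms in \<open>auto intro: span_base\<close>)
  have "\<exists>c. c \<in> span ?S \<and> (\<forall>i<k. b i \<bullet> c = (if i = j then 1 else 0))" if j: "j < k" for j
  proof -
    obtain h :: "'a \<Rightarrow> real" where h: "linear h" "\<forall>x\<in>?S. h x = (if x = b j then 1 else 0)"
      using linear_independent_extend[OF ind, of "\<lambda>x. if x = b j then 1 else 0"] by blast
    obtain y z where yz: "y \<in> span ?S" "\<And>w. w \<in> span ?S \<Longrightarrow> orthogonal z w" "adjoint h 1 = y + z"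
      using orthogonal_subspace_decomp_exists[of ?S "adjoint h 1"] by metis
    have "b i \<bullet> y = (if i = j then 1 else 0)" if i: "i < k" for i
    proof -
      have "b i \<bullet> z = 0" using yz(2)[of "b i"] i by (auto simp: orthogonal_def inner_commute intro: span_base)
      then have "b i \<bullet> y = b i \<bullet> adjoint h 1" by (simp add: yz(3) inner_add_right)
      also have "\<dots> = h (b i)" using adjoint_works[OF h(1), of "b i" 1] by simp
      also have "\<dots> = (if i = j then 1 else 0)"
        using h(2) i j inj by (auto simp: inj_on_def)
      finally show ?thesis .
    qed
    with yz(1) show ?thesis by blast
  qed
  then show ?thesis by metis
qed

text \<open>Stated as failure of uniqueness, which also admits an empty set of subgradients. Where
  every coordinate has a subgradient, a kink is a coordinate with a nondegenerate interval of
  them.\<close>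

definition kinks :: "('n \<Rightarrow> real \<Rightarrow> ereal) \<Rightarrow> real^'n::finite \<Rightarrow> 'n set" where
  "kinks gs x = {i. \<nexists>s. subgradients (gs i) (x $ i) = {s}}"

lemma eventually_coordinate_along_line:
  fixes x v :: "real^'n::finite"
  assumes "eventually P (nhds (x $ i))"
  shows "\<forall>\<^sub>F t in at_right 0. P ((x + t *\<^sub>R v) $ i)"
proof -
  have "((\<lambda>t. (x + t *\<^sub>R v) $ i) \<longlongrightarrow> (x + 0 *\<^sub>R v) $ i) (at_right 0)"
    by (intro tendsto_intros)
  then show ?thesis using assms by (intro eventually_compose_filterlim[where f="\<lambda>t. (x + t *\<^sub>R v) $ i"]) simp_all
qed

text \<open>Away from the kinks each summand has slope \<open>s i\<close>, and at the kinks
  \<open>v\<close> does not move, so to first order the sum grows along \<open>v\<close> no faster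
  than these slopes allow.\<close>

lemma subderivative_separable_le:
  fixes gs :: "'n::finite \<Rightarrow> real \<Rightarrow> ereal" and x v :: "real^'n"
  assumes gs: "\<And>i. convex_fun (gs i)" "\<And>i t. gs i t \<noteq> -\<infinity>"
    and fin: "\<And>i. gs i (x $ i) = ereal (a i)"
    and s: "\<And>i. i \<notin> kinks gs x \<Longrightarrow> subgradients (gs i) (x $ i) = {s i}"
    and v: "\<And>i. i \<in> kinks gs x \<Longrightarrow> v $ i = 0"
  shows "subderivative (\<lambda>x. \<Sum>i\<in>UNIV. gs i (x $ i)) x v \<le> ereal (\<Sum>i\<in>UNIV. s i * v $ i)"
proof -
  let ?g = "\<lambda>x. \<Sum>i\<in>UNIV. gs i (x $ i)"
  have gx: "?g x = ereal (\<Sum>i\<in>UNIV. a i)" by (simp add: fin)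
  define K where "K = (\<Sum>i\<in>UNIV. \<bar>v $ i\<bar>)"
  have K: "K \<ge> 0" by (simp add: K_def sum_nonneg)
  have "subderivative ?g x v \<le> ereal (\<Sum>i\<in>UNIV. s i * v $ i) + ereal e" if e: "e > 0" for e
  proof -
    \<comment> \<open>The coordinate errors add up to \<open>\<epsilon> * K\<close>; the summand 1
      covers the case \<open>K = 0\<close>.\<close>
    define \<epsilon> where "\<epsilon> = e / (K + 1)"
    have \<epsilon>: "\<epsilon> > 0" using e K by (simp add: \<epsilon>_def)
    have \<epsilon>K: "\<epsilon> * K \<le> e" using e K by (simp add: \<epsilon>_def field_simps)
    have each: "\<forall>\<^sub>F t in at_right 0. gs i ((x + t *\<^sub>R v) $ i) \<le> ereal (a i + t * (s i * v $ i + \<epsilon> * \<bar>v $ i\<bar>))" for i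
    proof (cases "i \<in> kinks gs x")
      case True
      then show ?thesis using v[OF True] fin[of i] by simp
    next
      case False
      from eventually_coordinate_along_line[OF unique_subgradient_upper_bound[OF gs(1) fin s[OF False] \<epsilon>], of v]
        eventually_at_right_less[of 0]
      show ?thesis
        by eventually_elim (simp add: algebra_simps abs_mult)
    qed
    have "\<forall>\<^sub>F t in at_right 0. \<forall>i. gs i ((x + t *\<^sub>R v) $ i) \<le> ereal (a i + t * (s i * v $ i + \<epsilon> * \<bar>v $ i\<bar>))"
      by (intro eventually_all_finite each)
    then have "\<forall>\<^sub>F t in at_right 0. ?g (x + t *\<^sub>R v) \<le>
        ereal ((\<Sum>i\<in>UNIV. a i) + t * ((\<Sum>i\<in>UNIV. s i * v $ i) + \<epsilon> * K))"
    proof eventually_elim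
      case (elim t)
      have "?g (x + t *\<^sub>R v) \<le> (\<Sum>i\<in>UNIV. ereal (a i + t * (s i * v $ i + \<epsilon> * \<bar>v $ i\<bar>)))"
        using elim by (intro sum_mono) simp
      also have "\<dots> = ereal ((\<Sum>i\<in>UNIV. a i) + t * ((\<Sum>i\<in>UNIV. s i * v $ i) + \<epsilon> * K))"
        by (simp add: K_def sum.distrib sum_distrib_left distrib_left)
      finally show ?case .
    qed
    from subderivative_le[of ?g x, OF gx this] show ?thesis
      by (rule order.trans) (use \<epsilon>K in simp)
  qed
  then show ?thesis by (rule ereal_le_epsilon2[rule_format])
qed

text \<open>If \<open>v\<close> vanished at all kinks, one linear form would bound the subderivative
  from above at both \<open>v\<close> and \<open>- v\<close>; its values there are opposite, which
  contradicts sharpness.\<close>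

lemma sharp_direction_meets_kinks:
  fixes gs :: "'n::finite \<Rightarrow> real \<Rightarrow> ereal" and x v :: "real^'n"
  assumes gs: "\<And>i. convex_fun (gs i)" "\<And>i t. gs i t \<noteq> -\<infinity>"
    and fin: "\<And>i. gs i (x $ i) = ereal (a i)"
    and sharp: "subderivative (\<lambda>x. \<Sum>i\<in>UNIV. gs i (x $ i)) x (- v) >
      - subderivative (\<lambda>x. \<Sum>i\<in>UNIV. gs i (x $ i)) x v"
  shows "\<exists>i\<in>kinks gs x. v $ i \<noteq> 0"
proof (rule ccontr)
  assume "\<not> ?thesis"
  then have v: "\<And>i. i \<in> kinks gs x \<Longrightarrow> v $ i = 0" by blast
  define s where "s i = (SOME s. subgradients (gs i) (x $ i) = {s})" for i
  have s: "subgradients (gs i) (x $ i) = {s i}" if "i \<notin> kinks gs x" for i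
    unfolding s_def by (rule someI_ex) (use that in \<open>simp add: kinks_def\<close>)
  let ?d = "subderivative (\<lambda>x. \<Sum>i\<in>UNIV. gs i (x $ i)) x"
  have "?d v \<le> ereal (\<Sum>i\<in>UNIV. s i * v $ i)"
    by (rule subderivative_separable_le[OF gs fin s v])
  then have "ereal (- (\<Sum>i\<in>UNIV. s i * v $ i)) \<le> - ?d v"
    by (metis ereal_minus_le_minus uminus_ereal.simps(1))
  moreover have "?d (- v) \<le> ereal (\<Sum>i\<in>UNIV. s i * (- v) $ i)"
    by (rule subderivative_separable_le[OF gs fin s]) (use v in simp_all)
  then have "?d (- v) \<le> ereal (- (\<Sum>i\<in>UNIV. s i * v $ i))" by (simp add: sum_negf)
  ultimately have "?d (- v) \<le> - ?d v" by (rule order.trans[rotated])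
  with sharp show False by simp
qed

text \<open>Subgradients at a point with a different \<open>i\<close>-th coordinate stay, by monotonicity, away
  from the interior of the interval \<open>subgradients (gs i) (x $ i)\<close>, which contradicts inner
  semicontinuity.\<close>

lemma kinks_constant_on_manifold:
  fixes gs :: "'n::finite \<Rightarrow> real \<Rightarrow> ereal" and x :: "real^'n"
  assumes g: "g = (\<lambda>x. \<Sum>i\<in>UNIV. gs i (x $ i))"
    and gs: "\<And>i. convex_fun (gs i)" "\<And>i t. gs i t \<noteq> -\<infinity>"
    and reg: "\<forall>\<^sub>F y in nhds x. y \<in> M \<longrightarrow> regular_at g y \<and> subdiff g y \<noteq> {}"
    and cont: "setvalued_continuous_at_rel (clarke_subdiff g) M x"
    and xM: "x \<in> M" and i: "i \<in> kinks gs x"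
  shows "\<forall>\<^sub>F y in nhds x. y \<in> M \<longrightarrow> y $ i = x $ i"
proof -
  have conv: "convex_fun g" unfolding g by (rule convex_fun_separable[OF gs])
  \<comment> \<open>Regularity identifies the Clarke normal cone with the regular one, and for a
    convex function the latter describes ordinary subgradients.\<close>
  have cl: "clarke_subdiff g y = subgradients g y" if "regular_at g y" for y
    using that subdiff_convex[OF conv, of y] by (simp add: regular_at_def clarke_subdiff_def subdiff_def)
  have sep: "u \<in> subgradients g y \<longleftrightarrow> (\<forall>i. u $ i \<in> subgradients (gs i) (y $ i))" for u y
    unfolding g by (rule subgradients_separable[OF gs(2)])
  have regx: "regular_at g x" "subdiff g x \<noteq> {}" using eventually_nhds_x_imp_x[OF reg] xM by auto
  then obtain u0 where u0: "u0 \<in> subgradients g x" using subdiff_convex[OF conv] by auto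
  obtain s1 s2 where s12: "s1 \<in> subgradients (gs i) (x $ i)" "s2 \<in> subgradients (gs i) (x $ i)" "s1 < s2"
  proof -
    have "u0 $ i \<in> subgradients (gs i) (x $ i)" using u0 sep by blast
    moreover obtain s' where "s' \<in> subgradients (gs i) (x $ i)" "s' \<noteq> u0 $ i"
      using i \<open>u0 $ i \<in> _\<close> unfolding kinks_def by blast
    ultimately show ?thesis using that by (metis neqE)
  qed
  \<comment> \<open>The midpoint leaves room on both sides for nearby subgradients, and by
    separability it may replace the \<open>i\<close>-th coordinate of \<open>u0\<close> on its
    own.\<close>
  define \<sigma> where "\<sigma> = (s1 + s2) / 2"
  have "(1/2) *\<^sub>R s1 + (1/2) *\<^sub>R s2 \<in> subgradients (gs i) (x $ i)"
    using s12 by (intro convexD[OF convex_subgradients]) auto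
  then have \<sigma>: "\<sigma> \<in> subgradients (gs i) (x $ i)" by (simp add: \<sigma>_def add_divide_distrib)
  define u where "u = (\<chi> j. if j = i then \<sigma> else u0 $ j)"
  have u: "u \<in> clarke_subdiff g x"
    unfolding cl[OF regx(1)] sep using u0[unfolded sep] \<sigma> by (simp add: u_def)
  have "\<forall>\<^sub>F n in sequentially. xs n $ i = x $ i" if xs: "(\<forall>n. xs n \<in> M) \<and> xs \<longlonglongrightarrow> x" for xs
  proof -
    obtain us where us: "us \<longlonglongrightarrow> u" "\<forall>\<^sub>F n in sequentially. us n \<in> clarke_subdiff g (xs n)"
      using cont u xs unfolding setvalued_continuous_at_rel_def by blast
    have "\<forall>\<^sub>F n in sequentially. regular_at g (xs n)"
      using eventually_compose_filterlim[OF reg, of xs sequentially] xs by (auto elim: eventually_mono)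
    moreover have "(\<lambda>n. us n $ i) \<longlonglongrightarrow> \<sigma>"
      using tendsto_vec_nth[OF us(1), of i] by (simp add: u_def)
    then have "\<forall>\<^sub>F n in sequentially. s1 < us n $ i" "\<forall>\<^sub>F n in sequentially. us n $ i < s2"
      using s12(3) by (auto simp: \<sigma>_def intro: order_tendstoD)
    ultimately show ?thesis using us(2)
    proof eventually_elim
      case (elim n)
      then have mem: "us n $ i \<in> subgradients (gs i) (xs n $ i)" using cl sep by blast
      \<comment> \<open>The same difference has nonnegative products with a positive and a negative
        factor, so it is 0.\<close>
      have "(us n $ i - s1) * (xs n $ i - x $ i) \<ge> 0" "(us n $ i - s2) * (xs n $ i - x $ i) \<ge> 0"
        by (rule subgradients_real_monotone[OF mem s12(1)], rule subgradients_real_monotone[OF mem s12(2)])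
      then show "xs n $ i = x $ i" using elim by (auto simp: zero_le_mult_iff)
    qed
  qed
  then have "eventually (\<lambda>y. y $ i = x $ i) (inf (nhds x) (principal M))"
    by (intro sequentially_imp_eventually_nhds_within) blast
  then show ?thesis by (simp add: eventually_inf_principal)
qed

text \<open>With \<open>c\<close> a dual basis of the gradients \<open>b\<close>, the map
  \<open>\<Psi> y = (\<Sum>j. (G j y - b j \<bullet> (y - x)) *\<^sub>R c j) + (y - x)\<close> has identity derivative at \<open>x\<close> and
  \<open>b j \<bullet> \<Psi> y = G j y\<close>. It is open at \<open>x\<close>, so each \<open>y\<close> near \<open>x\<close> differs by a normal vector
  from a point of \<open>M\<close>; for \<open>y \<in> x + W\<close> that vector lies in \<open>W\<close>, hence vanishes.\<close>

lemma manifold_contains_subspace: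
  fixes x :: "real^'n::finite"
  assumes eq: "local_equation p r G M x" and p: "p \<ge> 1"
    and W: "subspace W"
    and MW: "\<forall>\<^sub>F y in nhds x. y \<in> M \<longrightarrow> y - x \<in> W"
    and NW: "\<And>v. v \<in> normal_space r G x \<Longrightarrow> v \<in> W \<Longrightarrow> v = 0"
  shows "\<forall>\<^sub>F y in nhds x. y - x \<in> W \<longrightarrow> y \<in> M"
proof -
  define k where "k = CARD('n) - r"
  define b where "b j = grad (G j) x" for j
  have xM: "x \<in> M" and Ck: "\<And>j. j < k \<Longrightarrow> Ck_on p (G j) UNIV" and dimb: "dim (b ` {..<k}) = k"
    using eq by (auto simp: local_equation_def k_def b_def[abs_def])
  obtain e where e: "e > 0" "M \<inter> ball x e = {y \<in> ball x e. \<forall>j<k. G j y = 0}"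
    using eq by (auto simp: local_equation_def k_def)
  obtain c where c: "\<And>j. j < k \<Longrightarrow> c j \<in> span (b ` {..<k})"
    "\<And>i j. i < k \<Longrightarrow> j < k \<Longrightarrow> b i \<bullet> c j = (if i = j then 1 else 0)"
    using dual_basis_exists[OF dimb] by blast
  have span_normal: "span (b ` {..<k}) \<subseteq> normal_space r G x"
    unfolding normal_space_def
    by (rule span_minimal[OF _ subspace_orthogonal_comp])
      (auto simp: orthogonal_comp_def tangent_space_def orthogonal_def b_def k_def inner_commute)
  have bsum: "b i \<bullet> (\<Sum>j<k. h j *\<^sub>R c j) = h i" if "i < k" for i h
  proof -
    have "b i \<bullet> (\<Sum>j<k. h j *\<^sub>R c j) = (\<Sum>j<k. if i = j then h j else 0)"
      unfolding inner_sum_right by (rule sum.cong) (simp_all add: c(2) that)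
    then show ?thesis using that by simp
  qed
  define N where "N h = (\<Sum>j<k. h j *\<^sub>R c j)" for h
  have N: "N h \<in> normal_space r G x" for h
    unfolding N_def by (intro subsetD[OF span_normal] span_sum span_scale c(1)) simp
  define \<Psi> where "\<Psi> y = N (\<lambda>j. G j y - b j \<bullet> (y - x)) + (y - x)" for y
  have b\<Psi>: "b i \<bullet> \<Psi> y = G i y" if "i < k" for i y
    using bsum[OF that] by (simp add: \<Psi>_def N_def inner_add_right)
  have diffG: "G j differentiable (at y)" if "j < k" for j y
  proof -
    have "Ck_on (Suc 0) (G j) UNIV" by (rule Ck_on_le[OF _ Ck[OF that]]) (use p in simp)
    then show ?thesis by simp
  qed
  have dG: "(G j has_derivative (\<lambda>v. b j \<bullet> v)) (at x)" if "j < k" for j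
  proof -
    have "frechet_derivative (G j) (at x) = (\<lambda>v. b j \<bullet> v)"
      using frechet_derivative_eq_grad[OF diffG[OF that]] by (auto simp: b_def)
    with iffD1[OF frechet_derivative_works diffG[OF that, of x]] show ?thesis by simp
  qed
  have der: "(\<Psi> has_derivative id) (at x)"
  proof -
    have "((\<lambda>y. (G j y - b j \<bullet> (y - x)) *\<^sub>R c j) has_derivative (\<lambda>v. 0)) (at x)" if "j < k" for j
    proof -
      have "((\<lambda>y. b j \<bullet> (y - x)) has_derivative (\<lambda>v. b j \<bullet> v)) (at x)"
        by (auto intro!: derivative_eq_intros)
      from has_derivative_scaleR_left[OF has_derivative_diff[OF dG[OF that] this], of "c j"]
      show ?thesis by simp
    qed
    then have "((\<lambda>y. N (\<lambda>j. G j y - b j \<bullet> (y - x))) has_derivative (\<lambda>v. \<Sum>j<k. 0)) (at x)"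
      unfolding N_def by (intro has_derivative_sum) auto
    moreover have "((\<lambda>y. y - x) has_derivative (\<lambda>v. v)) (at x)"
      by (auto intro!: derivative_eq_intros)
    ultimately have "(\<Psi> has_derivative (\<lambda>v. (\<Sum>j<k. 0) + v)) (at x)"
      unfolding \<Psi>_def by (rule has_derivative_add)
    then show ?thesis by (simp add: id_def)
  qed
  have contG: "continuous_on UNIV (G j)" if "j < k" for j
    using diffG[OF that] by (simp add: continuous_at_imp_continuous_on differentiable_imp_continuous_within)
  have cont\<Psi>: "continuous_on UNIV \<Psi>"
    unfolding \<Psi>_def N_def by (intro continuous_intros contG) auto
  obtain d where d: "d > 0" "\<And>y. dist y x < d \<Longrightarrow> y \<in> M \<Longrightarrow> y - x \<in> W"
    using MW by (auto simp: eventually_nhds_metric)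
  \<comment> \<open>Within \<open>e\<close> the equations describe \<open>M\<close>, within
    \<open>d\<close> the points of \<open>M\<close> lie in \<open>x + W\<close>; the point
    \<open>z\<close> found below needs both.\<close>
  define \<epsilon> where "\<epsilon> = min e d"
  have \<epsilon>: "\<epsilon> > 0" "\<epsilon> \<le> e" "\<epsilon> \<le> d" using e d by (auto simp: \<epsilon>_def)
  \<comment> \<open>The derivative at \<open>x\<close> is the identity, hence onto, so the image of
    a ball around \<open>x\<close> covers a neighbourhood of \<open>\<Psi> x\<close>.\<close>
  have "\<Psi> x \<in> interior (\<Psi> ` ball x \<epsilon>)"
    by (rule sussmann_open_mapping[OF open_UNIV cont\<Psi> _ der bounded_linear_ident[folded id_def]])
      (use \<epsilon> in \<open>auto simp: interior_open\<close>)
  moreover have "\<Psi> x = 0"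
  proof -
    have "G j x = 0" if "j < k" for j
    proof -
      have "x \<in> M \<inter> ball x e" using xM e(1) by simp
      then show ?thesis using e(2) that by blast
    qed
    then show ?thesis by (simp add: \<Psi>_def N_def)
  qed
  ultimately have "\<forall>\<^sub>F t in nhds 0. t \<in> interior (\<Psi> ` ball x \<epsilon>)"
    by (intro eventually_nhds_in_open) auto
  \<comment> \<open>\<open>\<tau> y\<close> is \<open>y - x\<close> corrected by a normal vector so
    that its inner products with all \<open>b i\<close> vanish. Any \<open>z\<close> with
    \<open>\<Psi> z = \<tau> y\<close> therefore solves the equations, and \<open>z - y\<close> is
    normal.\<close>
  moreover define \<tau> where "\<tau> y = (y - x) - N (\<lambda>j. b j \<bullet> (y - x))" for y
  have "(\<tau> \<longlongrightarrow> \<tau> x) (nhds x)"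
    unfolding \<tau>_def N_def by (intro tendsto_intros filterlim_ident)
  then have "(\<tau> \<longlongrightarrow> 0) (nhds x)" by (simp add: \<tau>_def N_def)
  ultimately have "\<forall>\<^sub>F y in nhds x. \<tau> y \<in> interior (\<Psi> ` ball x \<epsilon>)"
    by (rule eventually_compose_filterlim)
  then show ?thesis
  proof eventually_elim
    case (elim y)
    show ?case
    proof
      assume y: "y - x \<in> W"
      obtain z where z: "z \<in> ball x \<epsilon>" "\<Psi> z = \<tau> y" using subsetD[OF interior_subset elim] by force
      have "b i \<bullet> \<tau> y = 0" if "i < k" for i
        using bsum[OF that] by (simp add: \<tau>_def N_def inner_diff_right)
      then have G0: "G i z = 0" if "i < k" for i using b\<Psi>[OF that, of z] z(2) that by simp
      then have zM: "z \<in> M" using z(1) \<epsilon> e(2) by auto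
      have "z - x \<in> W" using d(2)[OF _ zM] z(1) \<epsilon> by (auto simp: dist_commute)
      from subspace_diff[OF W this y] have "z - y \<in> W" by simp
      moreover have "z - y \<in> normal_space r G x"
      proof -
        have sub: "subspace (normal_space r G x)"
          unfolding normal_space_def by (rule subspace_orthogonal_comp)
        have zy: "z - y = - N (\<lambda>j. b j \<bullet> (y - x)) - N (\<lambda>j. G j z - b j \<bullet> (z - x))"
          using z(2) unfolding \<Psi>_def \<tau>_def by (simp add: algebra_simps)
        show ?thesis unfolding zy by (intro subspace_diff subspace_neg sub N)
      qed
      ultimately have "z = y" using NW by (metis eq_iff_diff_eq_0)
      then show "y \<in> M" using zM by simp
    qed
  qed
qed

text \<open>Since \<open>i\<close> is not a kink, the line through \<open>x\<close> in direction
  \<open>i\<close> lies in \<open>x + W\<close>, hence near \<open>x\<close> in \<open>M\<close>,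
  where \<open>g\<close> agrees with a smooth function. Along it the other summands are constant, so
  \<open>gs i\<close> inherits the smoothness.\<close>

lemma active_manifold_smooth_coordinate:
  fixes gs :: "'n::finite \<Rightarrow> real \<Rightarrow> ereal" and x :: "real^'n"
  assumes g: "g = (\<lambda>x. \<Sum>i\<in>UNIV. gs i (x $ i))"
    and gs: "\<And>i. convex_fun (gs i)" "\<And>i t. gs i t \<noteq> -\<infinity>"
    and active: "active_manifold p g M x" and p: "p \<ge> 1"
    and i: "i \<notin> kinks gs x"
  shows "\<exists>U h. open U \<and> x $ i \<in> U \<and> Ck_on p h U \<and> (\<forall>t\<in>U. gs i t = ereal (h t))"
proof -
  obtain r G where eq: "local_equation p r G M x"
    and sharp: "\<And>\<nu>. \<nu> \<in> normal_space r G x \<Longrightarrow> \<nu> \<noteq> 0 \<Longrightarrow> subderivative g x (- \<nu>) > - subderivative g x \<nu>"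
    using active unfolding active_manifold_def by blast
  obtain U h where U: "open U" "x \<in> U" "Ck_on p h U" "\<And>y. y \<in> M \<inter> U \<Longrightarrow> g y = ereal (h y)"
    using active unfolding active_manifold_def by blast
  have reg: "\<forall>\<^sub>F y in nhds x. y \<in> M \<longrightarrow> regular_at g y \<and> subdiff g y \<noteq> {}"
    and cont: "setvalued_continuous_at_rel (clarke_subdiff g) M x"
    using active unfolding active_manifold_def by blast+
  have xM: "x \<in> M" using eq by (simp add: local_equation_def)
  have "\<bar>g x\<bar> \<noteq> \<infinity>" using eventually_nhds_x_imp_x[OF reg] xM by (simp add: regular_at_def)
  then have fin: "\<forall>i. \<bar>gs i (x $ i)\<bar> \<noteq> \<infinity>"
    using sum_ereal_finite_iff[of UNIV "\<lambda>i. gs i (x $ i)", OF finite gs(2)] unfolding g by simp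
  define a where "a i = real_of_ereal (gs i (x $ i))" for i
  have a: "gs i (x $ i) = ereal (a i)" for i using fin by (simp add: a_def ereal_real)
  define W where "W = {v::real^'n. \<forall>i\<in>kinks gs x. v $ i = 0}"
  have W: "subspace W" by (simp add: W_def subspace_def)
  have MW: "\<forall>\<^sub>F y in nhds x. y \<in> M \<longrightarrow> y - x \<in> W"
  proof -
    have "\<forall>\<^sub>F y in nhds x. \<forall>i\<in>kinks gs x. y \<in> M \<longrightarrow> y $ i = x $ i"
      by (intro eventually_ball_finite ballI kinks_constant_on_manifold[OF g gs reg cont xM]) auto
    then show ?thesis by eventually_elim (simp add: W_def)
  qed
  have NW: "v = 0" if "v \<in> normal_space r G x" "v \<in> W" for v
  proof (rule ccontr)
    assume "v \<noteq> 0"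
    from sharp_direction_meets_kinks[OF gs a sharp[OF that(1) this, unfolded g]] that(2)
    show False by (simp add: W_def)
  qed
  define l where "l t = x + (t - x $ i) *\<^sub>R axis i 1" for t
  have lx: "l (x $ i) = x" by (simp add: l_def)
  have contl: "continuous_on UNIV l" unfolding l_def by (intro continuous_intros)
  from manifold_contains_subspace[OF eq p W MW NW]
  obtain V where V: "open V" "x \<in> V" "\<And>y. y \<in> V \<Longrightarrow> y - x \<in> W \<Longrightarrow> y \<in> M"
    by (auto simp: eventually_nhds)
  define T where "T = l -` (U \<inter> V)"
  have T: "open T" "x $ i \<in> T"
    using open_vimage[OF open_Int[OF U(1) V(1)] contl] U(2) V(2) lx by (auto simp: T_def)
  define C where "C = (\<Sum>j\<in>UNIV - {i}. a j)"
  have "gs i t = ereal (h (l t) + (- C))" if "t \<in> T" for t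
  proof -
    have "l t - x \<in> W" using i by (auto simp: l_def W_def axis_def)
    then have "g (l t) = ereal (h (l t))" using U(4) V(3) that by (auto simp: T_def)
    moreover have "g (l t) = gs i t + ereal C"
      unfolding g l_def sum_ereal_split by (simp add: a C_def)
    ultimately show ?thesis by (cases "gs i t") auto
  qed
  moreover have "Ck_on p l T"
    unfolding l_def diff_conv_add_uminus
    by (intro Ck_on_add Ck_on_scaleR Ck_on_const T(1) Ck_on_bounded_linear[OF bounded_linear_ident])
  then have "Ck_on p (\<lambda>t. h (l t) + (- C)) T"
    by (intro Ck_on_add Ck_on_const T(1) Ck_on_compose[OF T(1) U(1) _ _ U(3)]) (auto simp: T_def)
  ultimately show ?thesis using T by blast
qed

subsection \<open>Smoothness of the proximal sweep\<close>

text \<open>Completing the square and adding the subgradient inequality puts the objective at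
  \<open>z\<close> above its value at \<open>y\<close> by at least
  \<open>(norm (z - y))\<^sup>2 / (2 * \<beta>)\<close>. The minimizer is thus unique, which
  determines the choice made by \<open>prox\<close>.\<close>

lemma prox_subgradient:
  fixes \<phi> :: "'a::real_inner \<Rightarrow> ereal"
  assumes "s \<in> subgradients \<phi> y" "\<beta> > 0"
  shows "prox \<beta> \<phi> (y + \<beta> *\<^sub>R s) = y"
proof -
  let ?p = "y + \<beta> *\<^sub>R s"
  let ?\<Phi> = "\<lambda>z. \<phi> z + ereal (1 / (2 * \<beta>) * (norm (z - ?p))\<^sup>2)"
  obtain a where a: "\<phi> y = ereal a" using subgradients_finite[OF assms(1)] by blast
  have sq: "1 / (2 * \<beta>) * (norm (z - ?p))\<^sup>2 =
      \<beta> / 2 * (norm s)\<^sup>2 - s \<bullet> (z - y) + 1 / (2 * \<beta>) * (norm (z - y))\<^sup>2" for z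
  proof -
    have "(norm ((z - y) - \<beta> *\<^sub>R s))\<^sup>2 =
        (norm (z - y))\<^sup>2 - 2 * \<beta> * (s \<bullet> (z - y)) + \<beta> * \<beta> * (norm s)\<^sup>2"
      unfolding power2_norm_eq_inner inner_diff_left[of "z - y"] inner_diff_right[of _ "z - y"]
      by (simp add: inner_commute)
    then have "(norm (z - ?p))\<^sup>2 = (norm (z - y))\<^sup>2 - 2 * \<beta> * (s \<bullet> (z - y)) + \<beta> * \<beta> * (norm s)\<^sup>2"
      by (simp only: diff_diff_add)
    then show ?thesis using assms(2) by (simp add: field_simps)
  qed
  have y: "?\<Phi> y = ereal (a + \<beta> / 2 * (norm s)\<^sup>2)" by (simp only: sq a) simp
  have lb: "ereal (a + \<beta> / 2 * (norm s)\<^sup>2 + 1 / (2 * \<beta>) * (norm (z - y))\<^sup>2) \<le> ?\<Phi> z" for z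
  proof -
    have "ereal (a + s \<bullet> (z - y)) \<le> \<phi> z"
      by (rule subgradientsD[where \<phi>=\<phi> and x=y, OF assms(1) a])
    then have "ereal (a + s \<bullet> (z - y)) + ereal (1 / (2 * \<beta>) * (norm (z - ?p))\<^sup>2) \<le> ?\<Phi> z"
      by (rule add_right_mono)
    then show ?thesis unfolding sq plus_ereal.simps by (simp add: algebra_simps)
  qed
  have ge: "?\<Phi> y \<le> ?\<Phi> z" for z
  proof -
    have "?\<Phi> y \<le> ereal (a + \<beta> / 2 * (norm s)\<^sup>2 + 1 / (2 * \<beta>) * (norm (z - y))\<^sup>2)"
      unfolding y using assms(2) by simp
    then show ?thesis using lb by (rule order.trans)
  qed
  have uniq: "z = y" if "?\<Phi> z \<le> ?\<Phi> y" for z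
  proof -
    have "ereal (a + \<beta> / 2 * (norm s)\<^sup>2 + 1 / (2 * \<beta>) * (norm (z - y))\<^sup>2) \<le> ereal (a + \<beta> / 2 * (norm s)\<^sup>2)"
      using order.trans[OF lb that] unfolding y .
    then have "1 / (2 * \<beta>) * (norm (z - y))\<^sup>2 \<le> 0" by simp
    then show ?thesis using assms(2) by (simp add: mult_le_0_iff divide_le_0_iff)
  qed
  show ?thesis
    unfolding prox_def arg_min_def is_arg_min_def
  proof (rule some_equality)
    show "True \<and> \<not> (\<exists>z. True \<and> ?\<Phi> z < ?\<Phi> y)" using ge by (simp add: not_less)
  next
    fix z assume "True \<and> \<not> (\<exists>y. True \<and> ?\<Phi> y < ?\<Phi> z)"
    then show "z = y" using uniq by (metis not_less)
  qed
qed

text \<open>By convexity all slopes from \<open>s1\<close> to \<open>s2\<close> are subgradients at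
  \<open>x\<close>, so every \<open>z\<close> near \<open>x + \<beta> * \<sigma>\<close> is
  \<open>x\<close> plus \<beta> times a subgradient at the same \<open>x\<close>.\<close>

lemma prox_locally_constant:
  fixes \<phi> :: "real \<Rightarrow> ereal"
  assumes "\<beta> > 0" "s1 \<in> subgradients \<phi> x" "s2 \<in> subgradients \<phi> x" "s1 < \<sigma>" "\<sigma> < s2"
  shows "\<forall>\<^sub>F z in nhds (x + \<beta> * \<sigma>). prox \<beta> \<phi> z = x"
proof -
  have "prox \<beta> \<phi> z = x" if "z \<in> {x + \<beta> * s1<..<x + \<beta> * s2}" for z
  proof -
    let ?s = "(z - x) / \<beta>"
    have "s1 < ?s" "?s < s2" using that assms(1) by (auto simp: field_simps)
    then have "?s \<in> {s1..s2}" by simp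
    also have "\<dots> \<subseteq> subgradients \<phi> x"
      using convex_contains_segment[THEN iffD1, OF convex_subgradients[of \<phi> x]] assms
      by (metis closed_segment_eq_real_ivl less_imp_le order.strict_trans)
    finally show ?thesis using prox_subgradient[of ?s \<phi> x \<beta>] assms(1) by simp
  qed
  moreover have "\<forall>\<^sub>F z in nhds (x + \<beta> * \<sigma>). z \<in> {x + \<beta> * s1<..<x + \<beta> * s2}"
    using assms by (intro eventually_nhds_in_open) auto
  ultimately show ?thesis by (rule eventually_mono[rotated])
qed

text \<open>On \<open>U\<close> the proximal map is a left inverse of \<open>y \<mapsto> y + \<beta> h'(y)\<close>, whose derivative is at
  least 1 by convexity.\<close>

lemma prox_smooth:
  fixes \<phi> :: "real \<Rightarrow> ereal"
  assumes \<beta>: "\<beta> > 0" and conv: "convex_fun \<phi>" and U: "open U" "x \<in> U"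
    and h: "Ck_on (Suc k) h U" and \<phi>h: "\<And>t. t \<in> U \<Longrightarrow> \<phi> t = ereal (h t)" and k: "k \<ge> 1"
    and \<sigma>: "subgradients \<phi> x = {\<sigma>}"
  shows "Ck_near k (prox \<beta> \<phi>) (x + \<beta> * \<sigma>)"
proof -
  define h' where "h' y = frechet_derivative h (at y) 1" for y
  have h'sub: "h' y \<in> subgradients \<phi> y" if y: "y \<in> U" for y
  proof (rule subgradientsI[where \<phi>=\<phi> and x=y, OF \<phi>h[OF y]])
    fix z
    have d: "(h has_derivative frechet_derivative h (at y)) (at y)"
      by (rule Ck_on_has_derivative[OF h y])
    have "\<forall>\<^sub>F t in nhds y. \<phi> t = ereal (h t)"
      using eventually_nhds_in_open[OF U(1) y] by eventually_elim (rule \<phi>h)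
    from convex_fun_derivative_bound[OF conv this d, of z]
    show "ereal (h y + h' y \<bullet> (z - y)) \<le> \<phi> z"
      using linear_cmul[OF has_derivative_linear[OF d], of "z - y" 1] by (simp add: h'_def mult.commute)
  qed
  have h'x: "h' x = \<sigma>" using h'sub[OF U(2)] \<sigma> by simp
  \<comment> \<open>Passing to \<open>h'\<close> costs one order, so an active manifold of order 3
    yields a proximal map of order 2.\<close>
  have Ckh': "Ck_on k h' U" unfolding h'_def using h by simp
  define P where "P y = y + \<beta> * h' y" for y
  have CkP: "Ck_on k P U"
    unfolding P_def real_scaleR_def[symmetric]
    by (intro Ck_on_add Ck_on_scaleR Ck_on_const Ck_on_bounded_linear[OF bounded_linear_ident] U(1) Ckh')
  have inv: "prox \<beta> \<phi> (P y) = y" if "y \<in> U" for y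
    using prox_subgradient[OF h'sub[OF that] \<beta>] by (simp add: P_def)
  have der: "frechet_derivative P (at y) 1 \<noteq> 0" if y: "y \<in> U" for y
  proof -
    have "Ck_on (Suc 0) h' U" by (rule Ck_on_le[OF _ Ckh']) (use k in simp)
    from Ck_on_has_derivative[OF this y]
    have d: "(h' has_derivative frechet_derivative h' (at y)) (at y)" .
    define D where "D = frechet_derivative h' (at y) 1"
    have lin: "frechet_derivative h' (at y) v = D * v" for v
      using linear_cmul[OF has_derivative_linear[OF d], of v 1] by (simp add: D_def)
    have "(h' has_real_derivative D) (at y)"
      using d ext[of "frechet_derivative h' (at y)" "(*) D", OF lin]
      unfolding has_field_derivative_def by simp
    moreover have "mono_on U h'"
    proof (rule mono_onI)
      fix a b assume ab: "a \<in> U" "b \<in> U" "a \<le> b"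
      have "(h' a - h' b) * (a - b) \<ge> 0"
        by (rule subgradients_real_monotone[OF h'sub[OF ab(1)] h'sub[OF ab(2)]])
      then show "h' a \<le> h' b" using ab(3) by (cases "a = b") (auto simp: zero_le_mult_iff)
    qed
    ultimately have "D \<ge> 0"
      using mono_on_imp_deriv_nonneg[of U h' D y] y U(1) by (simp add: interior_open)
    moreover have "(P has_derivative (\<lambda>v. v + \<beta> * frechet_derivative h' (at y) v)) (at y)"
      unfolding P_def by (intro has_derivative_add has_derivative_ident has_derivative_mult_right d)
    then have "frechet_derivative P (at y) 1 = 1 + \<beta> * D"
      by (simp add: frechet_derivative_at[symmetric] D_def)
    ultimately show ?thesis using \<beta> by (smt (verit) mult_nonneg_nonneg)
  qed
  have "open (P ` U) \<and> Ck_on k (prox \<beta> \<phi>) (P ` U)"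
    by (rule Ck_on_local_inverse[OF U(1) CkP inv der k])
  moreover have "x + \<beta> * \<sigma> \<in> P ` U"
    by (rule image_eqI[OF _ U(2)]) (simp add: P_def h'x)
  ultimately show ?thesis unfolding Ck_near_def by blast
qed

section \<open>From coordinate proximal maps to the sweep\<close>

lemma Ck_near_prox_coord_step:
  fixes f :: "real^'n::finite \<Rightarrow> real"
  assumes f: "Ck_near (Suc k) f x"
    and pr: "Ck_near k (prox \<beta> (gs j)) (x $ j - \<beta> * partial_deriv j f x)"
  shows "Ck_near k (prox_coord_step \<beta> f gs j) x"
  unfolding prox_coord_step_def
proof (rule Ck_near_vec)
  fix i
  obtain U where U: "open U" "x \<in> U" "Ck_on (Suc k) f U" using f by (auto simp: Ck_near_def)
  have coord: "Ck_on k (\<lambda>x. x $ i) U" for i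
    by (rule Ck_on_bounded_linear[OF bounded_linear_vec_nth U(1)])
  show "Ck_near k (\<lambda>x. if i = j then prox \<beta> (gs i) (x $ i - \<beta> * partial_deriv i f x) else x $ i) x"
  proof (cases "i = j")
    case False
    then show ?thesis using coord U(1,2) by (auto simp: Ck_near_def)
  next
    case True
    have "Ck_on k (\<lambda>x. x $ j + (- \<beta>) *\<^sub>R partial_deriv j f x) U"
      unfolding partial_deriv_def
      by (intro Ck_on_add Ck_on_scaleR Ck_on_const coord U(1) Ck_on_frechet_derivative U(3))
    then have "Ck_near k (\<lambda>x. x $ j - \<beta> * partial_deriv j f x) x"
      using U(1,2) by (auto simp: Ck_near_def)
    from Ck_near_compose[OF this pr] True show ?thesis by simp
  qed
qed

text \<open>Every step fixes \<open>x\<close>, so the repeated chain rule never leaves this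
  point.\<close>

lemma Ck_near_fold:
  fixes x :: "'a::euclidean_space"
  assumes "Ck_near k (\<lambda>x. x) x" "\<And>j. Ck_near k (\<psi> j) x" "\<And>j. \<psi> j x = x"
  shows "Ck_near k (fold \<psi> js) x \<and> fold \<psi> js x = x"
proof (induction js)
  case Nil
  then show ?case using assms(1) by (simp add: id_def)
next
  case (Cons j js)
  have "Ck_near k (\<lambda>y. fold \<psi> js (\<psi> j y)) x"
    by (rule Ck_near_compose[OF assms(2)]) (use Cons assms(3) in simp)
  then show ?case using Cons assms(3) by (simp add: comp_def)
qed

text \<open>Relative interiority lets the segment from a point of \<open>S\<close> to 0 be prolonged
  beyond 0. Applied to a point that differs from 0 in coordinate \<open>i\<close> only, this yields
  subgradients on both sides of \<open>- d $ i\<close>.\<close>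

lemma rel_interior_subgradients_kink:
  fixes gs :: "'n::finite \<Rightarrow> real \<Rightarrow> ereal" and d x :: "real^'n"
  assumes gs: "\<And>i t. gs i t \<noteq> -\<infinity>"
    and S: "\<And>s. s \<in> S \<longleftrightarrow> s - d \<in> subgradients (\<lambda>x. \<Sum>i\<in>UNIV. gs i (x $ i)) x"
    and rint: "0 \<in> rel_interior S" and i: "i \<in> kinks gs x"
  shows "\<exists>s1\<in>subgradients (gs i) (x $ i). \<exists>s2\<in>subgradients (gs i) (x $ i). s1 < - d $ i \<and> - d $ i < s2"
proof -
  let ?D = "subgradients (gs i) (x $ i)" and ?G = "subgradients (\<lambda>x. \<Sum>i\<in>UNIV. gs i (x $ i)) x"
  have sep: "u \<in> ?G \<longleftrightarrow> (\<forall>i. u $ i \<in> subgradients (gs i) (x $ i))" for u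
    by (rule subgradients_separable[OF gs])
  have 0: "0 \<in> S" using rint rel_interior_subset by blast
  then have d: "- d \<in> ?G" using S[of 0] by simp
  have "S = (+) d ` ?G"
  proof (intro set_eqI iffI)
    fix s assume "s \<in> S"
    then show "s \<in> (+) d ` ?G" using S[of s] by (intro image_eqI[of _ _ "s - d"]) auto
  next
    fix s assume "s \<in> (+) d ` ?G"
    then obtain u where "u \<in> ?G" "s = d + u" by blast
    then show "s \<in> S" using S[of s] by simp
  qed
  then have "convex S" using convex_translation[OF convex_subgradients] by metis
  have di: "- d $ i \<in> ?D" using d sep[of "- d"] by simp
  then obtain s where s: "s \<in> ?D" "s \<noteq> - d $ i" using i unfolding kinks_def by blast
  \<comment> \<open>Chosen so that \<open>y - d\<close> is \<open>- d\<close> with its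
    \<open>i\<close>-th entry replaced by \<open>s\<close>.\<close>
  define y :: "real^'n" where "y = (s + d $ i) *\<^sub>R axis i 1"
  have y: "(c *\<^sub>R y - d) $ j = (if j = i then c * (s + d $ i) - d $ i else - d $ j)" for j c
    by (simp add: y_def axis_def)
  have "1 *\<^sub>R y - d \<in> ?G" unfolding sep y using s(1) d sep[of "- d"] by simp
  then have "y \<in> S" using S[of y] by simp
  then obtain e where e: "e > 1" "(1 - e) *\<^sub>R y \<in> S"
    using rint convex_rel_interior_iff[OF \<open>convex S\<close>] 0 by fastforce
  have "(1 - e) *\<^sub>R y - d \<in> ?G" using e(2) S by blast
  then have t: "(1 - e) * (s + d $ i) - d $ i \<in> ?D" unfolding sep y by (metis (full_types))
  show ?thesis
  proof (cases "s < - d $ i")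
    case True
    then have "(1 - e) * (s + d $ i) > 0" using e by (intro mult_neg_neg) auto
    then show ?thesis using True s(1) t by (intro bexI[OF _ s(1)] bexI[OF _ t]) auto
  next
    case False
    then have "(1 - e) * (s + d $ i) < 0" using e s(2) by (intro mult_neg_pos) auto
    then show ?thesis using False s t by (intro bexI[OF _ t] bexI[OF _ s(1)]) auto
  qed
qed

subsection \<open>Anderson acceleration of a contraction\<close>

text \<open>Homogeneity: at \<open>p + t *\<^sub>R v\<close> with small \<open>t\<close>, the
  quadratic error is still of order \<open>t\<close> after division by \<open>t\<close>, so the
  contraction constant passes to the linear part in the limit.\<close>

lemma linearization_contraction:
  fixes H A :: "'a::real_normed_vector \<Rightarrow> 'a"
  assumes "\<rho> > 0" "e > 0" "linear A"
    and contr: "\<And>y. y \<in> cball p \<rho> \<Longrightarrow> norm (H y - p) \<le> \<gamma> * norm (y - p)"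
    and quad: "\<And>y. y \<in> ball p e \<Longrightarrow> norm (H y - p - A (y - p)) \<le> K * (norm (y - p))\<^sup>2"
  shows "norm (A v) \<le> \<gamma> * norm v"
proof (cases "v = 0")
  case True
  then show ?thesis using linear_0[OF assms(3)] by simp
next
  case False
  define s where "s = min \<rho> e / norm v"
  have s: "s > 0" using assms(1,2) False by (simp add: s_def)
  have "norm (A v) \<le> \<gamma> * norm v + K * (norm v)\<^sup>2 * t" if t: "t > 0" "t < s" for t
  proof -
    let ?y = "p + t *\<^sub>R v"
    have "t * norm v < min \<rho> e" using t False by (simp add: s_def field_simps)
    then have y: "?y \<in> cball p \<rho>" "?y \<in> ball p e" using t by (auto simp: dist_norm)
    have "t * norm (A v) = norm ((H ?y - p) - (H ?y - p - A (?y - p)))"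
      using t linear_cmul[OF assms(3)] by simp
    also have "\<dots> \<le> norm (H ?y - p) + norm (H ?y - p - A (?y - p))" by (rule norm_triangle_ineq4)
    also have "\<dots> \<le> \<gamma> * norm (?y - p) + K * (norm (?y - p))\<^sup>2"
      using contr[OF y(1)] quad[OF y(2)] by simp
    also have "\<dots> = t * (\<gamma> * norm v + K * (norm v)\<^sup>2 * t)"
      using t by (simp add: algebra_simps power2_eq_square)
    finally show ?thesis using t by simp
  qed
  then have ev: "\<forall>\<^sub>F t in at_right 0. norm (A v) \<le> \<gamma> * norm v + K * (norm v)\<^sup>2 * t"
    unfolding eventually_at_right_field using s by auto
  have "((\<lambda>t. \<gamma> * norm v + K * (norm v)\<^sup>2 * t) \<longlongrightarrow> \<gamma> * norm v + K * (norm v)\<^sup>2 * 0) (at_right 0)"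
    by (intro tendsto_intros)
  from tendsto_lowerbound[OF this ev] show ?thesis by simp
qed

text \<open>With \<open>\<Delta>\<close> the linearization errors, the new residual equals
  \<open>A (\<Sum>i. \<alpha> i *\<^sub>R r i) - (\<Sum>i. \<alpha> i *\<^sub>R \<Delta> i) + \<Delta>'\<close>; minimality of \<open>\<alpha>\<close> bounds
  the first term by \<open>\<gamma>\<close> times the latest residual, and the errors are quadratic.\<close>

lemma anderson_step:
  fixes H A :: "'a::real_normed_vector \<Rightarrow> 'a"
  assumes it: "anderson_iteration H m \<alpha> x"
    and \<gamma>: "0 < \<gamma>" "\<gamma> < 1" and K: "K \<ge> 0" and lin: "linear A"
    and contr: "\<And>y. norm (y - p) \<le> \<eta> \<Longrightarrow> norm (H y - p) \<le> \<gamma> * norm (y - p)"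
    and Abd: "\<And>v. norm (A v) \<le> \<gamma> * norm v"
    and quad: "\<And>y. norm (y - p) \<le> \<eta> \<Longrightarrow> norm (H y - p - A (y - p)) \<le> K * (norm (y - p))\<^sup>2"
    and coeff: "(\<Sum>i\<le>min m k. \<bar>\<alpha> k i\<bar>) \<le> B"
    and near: "\<And>j. j \<le> k \<Longrightarrow> norm (x j - p) \<le> \<eta>"
    and res: "\<And>i. i \<le> min m k \<Longrightarrow> norm (H (x (k - min m k + i)) - x (k - min m k + i)) \<le> R"
    and small: "B * \<gamma> / (1 - \<gamma>) * R \<le> \<eta>"
  shows "norm (x (Suc k) - p) \<le> B * \<gamma> / (1 - \<gamma>) * R"
    and "norm (H (x (Suc k)) - x (Suc k)) \<le>
      \<gamma> * norm (H (x k) - x k) + (B * K / (1 - \<gamma>)\<^sup>2 + K * (B * \<gamma> / (1 - \<gamma>))\<^sup>2) * R\<^sup>2"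
proof -
  define n where "n = min m k"
  define y where "y i = x (k - n + i)" for i
  define a where "a = \<alpha> k"
  define \<Delta> where "\<Delta> z = H z - p - A (z - p)" for z
  let ?C = "B * \<gamma> / (1 - \<gamma>)"
  have arg: "is_arg_min (\<lambda>a. (norm (\<Sum>i\<le>n. a i *\<^sub>R (H (y i) - y i)))\<^sup>2) (\<lambda>a. (\<Sum>i\<le>n. a i) = 1) a"
    and nxt: "x (Suc k) = (\<Sum>i\<le>n. a i *\<^sub>R H (y i))"
    using it unfolding anderson_iteration_def Let_def n_def y_def a_def by auto
  have suma: "(\<Sum>i\<le>n. a i) = 1" using arg by (simp add: is_arg_min_def)
  have absa: "(\<Sum>i\<le>n. \<bar>a i\<bar>) \<le> B" using coeff by (simp add: n_def a_def)
  have yk: "y n = x k" by (simp add: y_def n_def)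
  have neary: "norm (y i - p) \<le> \<eta>" if "i \<le> n" for i
    using near[of "k - n + i"] that by (auto simp: y_def n_def)
  have resy: "norm (H (y i) - y i) \<le> R" if "i \<le> n" for i
    using res[of i] that by (simp add: y_def n_def)
  have R0: "R \<ge> 0" using resy[of 0] norm_ge_zero order.trans by blast
  have B0: "B \<ge> 0" using absa by (meson abs_ge_zero order.trans sum_nonneg)
  \<comment> \<open>The contraction bounds the error by the residual:
    \<open>norm (y i - p) \<le> \<gamma> * norm (y i - p) + R\<close>. This is the origin of
    \<open>1 - \<gamma>\<close> in the constants.\<close>
  have ey: "norm (y i - p) \<le> R / (1 - \<gamma>)" if "i \<le> n" for i
  proof -
    have "norm (y i - p) \<le> norm (H (y i) - p) + norm (H (y i) - y i)"
using norm_triangle_ineq4[of "H (y i) - p" "H (y i) - y i"] by simp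
    also have "\<dots> \<le> \<gamma> * norm (y i - p) + R"
      using contr[OF neary[OF that]] resy[OF that] by simp
    finally show ?thesis using \<gamma> by (simp add: field_simps)
  qed
  have weighted: "norm (\<Sum>i\<le>n. a i *\<^sub>R w i) \<le> B * W" if "\<And>i. i \<le> n \<Longrightarrow> norm (w i) \<le> W" for w :: "nat \<Rightarrow> 'a" and W
  proof -
    have W0: "W \<ge> 0" using that[of 0] norm_ge_zero order.trans by blast
    have "norm (\<Sum>i\<le>n. a i *\<^sub>R w i) \<le> (\<Sum>i\<le>n. \<bar>a i\<bar> * W)"
      by (rule sum_norm_le) (auto intro!: mult_left_mono that)
    also have "\<dots> = (\<Sum>i\<le>n. \<bar>a i\<bar>) * W" by (simp add: sum_distrib_right)
    also have "\<dots> \<le> B * W" by (rule mult_right_mono[OF absa W0])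
    finally show ?thesis .
  qed
  have e': "x (Suc k) - p = (\<Sum>i\<le>n. a i *\<^sub>R (H (y i) - p))"
    by (simp add: nxt scaleR_diff_right sum_subtractf suma flip: scaleR_sum_left)
  show e'_le: "norm (x (Suc k) - p) \<le> ?C * R"
  proof -
    have "norm (H (y i) - p) \<le> \<gamma> * (R / (1 - \<gamma>))" if "i \<le> n" for i
      using order.trans[OF contr[OF neary[OF that]] mult_left_mono[OF ey[OF that]]] \<gamma> by simp
    then have "norm (x (Suc k) - p) \<le> B * (\<gamma> * (R / (1 - \<gamma>)))"
      unfolding e' by (rule weighted)
    then show ?thesis by simp
  qed
  \<comment> \<open>\<open>small\<close> keeps the new iterate within \<open>\<eta>\<close> of
    \<open>p\<close>, where the quadratic estimate holds.\<close>
  have \<Delta>': "norm (\<Delta> (x (Suc k))) \<le> K * ?C\<^sup>2 * R\<^sup>2"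
  proof -
    have "norm (\<Delta> (x (Suc k))) \<le> K * (norm (x (Suc k) - p))\<^sup>2"
      using quad[of "x (Suc k)"] e'_le small by (simp add: \<Delta>_def)
    also have "\<dots> \<le> K * (?C * R)\<^sup>2" by (intro mult_left_mono power_mono e'_le K) simp
    finally show ?thesis by (simp only: power_mult_distrib mult.assoc)
  qed
  have \<Delta>y: "norm (\<Sum>i\<le>n. a i *\<^sub>R \<Delta> (y i)) \<le> B * K / (1 - \<gamma>)\<^sup>2 * R\<^sup>2"
  proof -
    have "norm (\<Delta> (y i)) \<le> K * (R / (1 - \<gamma>))\<^sup>2" if "i \<le> n" for i
    proof -
      have "norm (\<Delta> (y i)) \<le> K * (norm (y i - p))\<^sup>2" using quad[OF neary[OF that]] by (simp add: \<Delta>_def)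
      also have "\<dots> \<le> K * (R / (1 - \<gamma>))\<^sup>2" by (intro mult_left_mono power_mono ey that K) simp
      finally show ?thesis .
    qed
    then have "norm (\<Sum>i\<le>n. a i *\<^sub>R \<Delta> (y i)) \<le> B * (K * (R / (1 - \<gamma>))\<^sup>2)"
      by (rule weighted)
    then show ?thesis by (simp add: power_divide)
  qed
  have min: "norm (\<Sum>i\<le>n. a i *\<^sub>R (H (y i) - y i)) \<le> norm (H (x k) - x k)"
  proof -
    \<comment> \<open>This competitor in the least-squares problem takes the newest residual alone;
      its index in the window is \<open>n\<close>.\<close>
    let ?u = "\<lambda>i. if i = n then 1 else (0::real)"
    have "(\<Sum>i\<le>n. ?u i) = 1" "(\<Sum>i\<le>n. ?u i *\<^sub>R (H (y i) - y i)) = H (x k) - x k"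
      by (simp_all add: yk if_distrib[where f="\<lambda>c. c *\<^sub>R _"] cong: if_cong)
    with arg have "(norm (\<Sum>i\<le>n. a i *\<^sub>R (H (y i) - y i)))\<^sup>2 \<le> (norm (H (x k) - x k))\<^sup>2"
      unfolding is_arg_min_linorder by metis
    then show ?thesis by (rule power2_le_imp_le) simp
  qed
  have "H (x (Suc k)) - x (Suc k) =
    A (\<Sum>i\<le>n. a i *\<^sub>R (H (y i) - y i)) - (\<Sum>i\<le>n. a i *\<^sub>R \<Delta> (y i)) + \<Delta> (x (Suc k))"
  proof -
    have "A (\<Sum>i\<le>n. a i *\<^sub>R (H (y i) - y i)) =
        A ((\<Sum>i\<le>n. a i *\<^sub>R (H (y i) - p)) - (\<Sum>i\<le>n. a i *\<^sub>R (y i - p)))"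
      by (simp add: algebra_simps flip: sum_subtractf)
    also have "\<dots> = A (x (Suc k) - p) - (\<Sum>i\<le>n. a i *\<^sub>R A (y i - p))"
      by (simp add: e' linear_diff[OF lin] linear_sum[OF lin] linear_cmul[OF lin])
    finally have "A (\<Sum>i\<le>n. a i *\<^sub>R (H (y i) - y i)) - (\<Sum>i\<le>n. a i *\<^sub>R \<Delta> (y i)) =
        A (x (Suc k) - p) - (\<Sum>i\<le>n. a i *\<^sub>R (H (y i) - p))"
      by (simp add: \<Delta>_def scaleR_diff_right sum_subtractf)
    then show ?thesis unfolding e'[symmetric] by (simp add: \<Delta>_def)
  qed
  then have "norm (H (x (Suc k)) - x (Suc k)) \<le>
      norm (A (\<Sum>i\<le>n. a i *\<^sub>R (H (y i) - y i))) + norm (\<Sum>i\<le>n. a i *\<^sub>R \<Delta> (y i)) + norm (\<Delta> (x (Suc k)))"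
    by (simp only: order.trans[OF norm_triangle_ineq add_right_mono[OF norm_triangle_ineq4]])
  also have "norm (A (\<Sum>i\<le>n. a i *\<^sub>R (H (y i) - y i))) \<le> \<gamma> * norm (H (x k) - x k)"
    by (rule order.trans[OF Abd mult_left_mono[OF min]]) (use \<gamma> in simp)
  also note \<Delta>y
  also note \<Delta>'
  finally show "norm (H (x (Suc k)) - x (Suc k)) \<le>
      \<gamma> * norm (H (x k) - x k) + (B * K / (1 - \<gamma>)\<^sup>2 + K * ?C\<^sup>2) * R\<^sup>2"
    by (simp only: distrib_right add.assoc)
qed

text \<open>Nearness and geometric decay need each other: nearness permits the one-step estimate,
  and the decay of the residuals keeps the next iterate near. Hence one joint induction on
  residuals, converted into errors only at the end.\<close>

lemma anderson_local_convergence: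
  fixes H A :: "'a::real_normed_vector \<Rightarrow> 'a"
  assumes \<rho>: "\<rho> > 0" and e: "e > 0" and \<gamma>: "0 < \<gamma>" "\<gamma> < 1" and K: "K \<ge> 0" and lin: "linear A"
    and fixp: "H p = p"
    and contr: "\<forall>x\<in>cball p \<rho>. \<forall>y\<in>cball p \<rho>. norm (H x - H y) \<le> \<gamma> * norm (x - y)"
    and quad: "\<And>y. y \<in> ball p e \<Longrightarrow> norm (H y - p - A (y - p)) \<le> K * (norm (y - p))\<^sup>2"
  shows "\<exists>\<delta>>0. \<exists>\<gamma>'\<in>{\<gamma><..<1}. \<forall>\<alpha> x.
    anderson_iteration H m \<alpha> x \<and> (\<forall>k. (\<Sum>i\<le>min m k. \<bar>\<alpha> k i\<bar>) \<le> B) \<and> norm (x 0 - p) \<le> \<delta> \<longrightarrow>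
    x \<longlonglongrightarrow> p \<and>
    (\<forall>k. norm (H (x k) - x k) \<le> \<gamma>' ^ k * norm (H (x 0) - x 0) \<and>
         norm (x k - p) \<le> (1 + \<gamma>) / (1 - \<gamma>) * \<gamma>' ^ k * norm (x 0 - p))"
proof -
  have contrp: "norm (H y - p) \<le> \<gamma> * norm (y - p)" if "y \<in> cball p \<rho>" for y
    using bspec[OF bspec[OF contr that], of p] \<rho> fixp by simp
  have Abd: "norm (A v) \<le> \<gamma> * norm v" for v
    by (rule linearization_contraction[OF \<rho> e lin contrp quad])
  define \<eta> where "\<eta> = min \<rho> (e / 2)"
  define g where "g = (1 + \<gamma>) / 2"
  \<comment> \<open>Coefficients with sum 1 have absolute sum at least 1, so nothing is lost; the
    maximum makes the constants nonnegative for every real \<open>B\<close>.\<close>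
  define M where "M = max B 1"
  define C where "C = M * \<gamma> / (1 - \<gamma>)"
  define Q where "Q = M * K / (1 - \<gamma>)\<^sup>2 + K * C\<^sup>2"
  \<comment> \<open>The first term keeps \<open>C * r 0\<close> below \<open>\<eta>\<close>, the
    second keeps \<open>Q * r 0\<close> below the gap \<open>g - \<gamma>\<close> times
    \<open>g ^ (2 * m)\<close>. The factor 2 bounds \<open>1 + \<gamma>\<close>; the summands 1 keep
    the denominators positive.\<close>
  define \<delta> where "\<delta> = min (\<eta> / (2 * (C + 1))) ((g - \<gamma>) * g ^ (2 * m) / (2 * (Q + 1)))"
  have g: "\<gamma> < g" "g < 1" "0 < g" using \<gamma> by (auto simp: g_def)
  have \<eta>: "\<eta> > 0" using \<rho> e by (simp add: \<eta>_def)
  have C: "C \<ge> 0" using \<gamma> by (simp add: C_def M_def)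
  have Q: "Q \<ge> 0" using \<gamma> K by (simp add: Q_def M_def)
  have \<delta>: "\<delta> > 0" using \<eta> C Q g by (simp add: \<delta>_def)
  have \<delta>1: "2 * \<delta> * (C + 1) \<le> \<eta>"
  proof -
    have "\<delta> \<le> \<eta> / (2 * (C + 1))" by (simp add: \<delta>_def)
    then show ?thesis using C by (simp add: field_simps)
  qed
  have \<delta>2: "2 * \<delta> * (Q + 1) \<le> (g - \<gamma>) * g ^ (2 * m)"
  proof -
    have "\<delta> \<le> (g - \<gamma>) * g ^ (2 * m) / (2 * (Q + 1))" by (simp add: \<delta>_def)
    then show ?thesis using Q by (simp add: field_simps)
  qed
  have contr\<eta>: "norm (H y - p) \<le> \<gamma> * norm (y - p)" if "norm (y - p) \<le> \<eta>" for y
    using that by (intro contrp) (auto simp: \<eta>_def dist_norm norm_minus_commute)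
  have quad\<eta>: "norm (H y - p - A (y - p)) \<le> K * (norm (y - p))\<^sup>2" if "norm (y - p) \<le> \<eta>" for y
    using that e by (intro quad) (auto simp: \<eta>_def dist_norm norm_minus_commute)
  have main: "x \<longlonglongrightarrow> p \<and>
      (\<forall>k. norm (H (x k) - x k) \<le> g ^ k * norm (H (x 0) - x 0) \<and>
         norm (x k - p) \<le> (1 + \<gamma>) / (1 - \<gamma>) * g ^ k * norm (x 0 - p))"
    if it: "anderson_iteration H m \<alpha> x" and B: "\<And>k. (\<Sum>i\<le>min m k. \<bar>\<alpha> k i\<bar>) \<le> B"
      and x0: "norm (x 0 - p) \<le> \<delta>" for \<alpha> x
  proof -
    define r where "r k = norm (H (x k) - x k)" for k
    have x0\<eta>: "norm (x 0 - p) \<le> \<eta>"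
    proof -
      have "\<delta> \<le> 2 * \<delta> * (C + 1)" using \<delta> C by (simp add: field_simps)
      then show ?thesis using x0 \<delta>1 by linarith
    qed
    have r0': "r 0 \<le> (1 + \<gamma>) * norm (x 0 - p)"
    proof -
      have "r 0 \<le> norm (H (x 0) - p) + norm (x 0 - p)"
        using norm_triangle_ineq4[of "H (x 0) - p" "x 0 - p"] by (simp add: r_def)
      then show ?thesis using contr\<eta>[OF x0\<eta>] by (simp add: algebra_simps)
    qed
    have r0: "r 0 \<le> 2 * \<delta>" "r 0 \<ge> 0"
    proof -
      have "(1 + \<gamma>) * norm (x 0 - p) \<le> 2 * \<delta>" using x0 \<gamma> by (intro mult_mono) auto
      then show "r 0 \<le> 2 * \<delta>" using r0' by simp
    qed (simp add: r_def)
    have Cr0: "C * r 0 \<le> \<eta>"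
    proof -
      have "C * r 0 \<le> (C + 1) * (2 * \<delta>)" using r0 C by (intro mult_mono) auto
      then show ?thesis using \<delta>1 by (simp add: mult.commute)
    qed
    have Qr0: "Q * r 0 \<le> (g - \<gamma>) * g ^ (2 * m)"
    proof -
      have "Q * r 0 \<le> (Q + 1) * (2 * \<delta>)" using r0 Q by (intro mult_mono) auto
      then show ?thesis using \<delta>2 by (simp add: mult.commute)
    qed
    have ind: "norm (x k - p) \<le> \<eta> \<and> r k \<le> g ^ k * r 0" for k
    proof (induction k rule: less_induct)
      case (less k)
      show ?case
      proof (cases k)
        case 0
        then show ?thesis using x0\<eta> by simp
      next
        case (Suc l)
        \<comment> \<open>As \<open>g < 1\<close>, the bound for the oldest residual in the window,
          of index \<open>l - min m l\<close>, covers the whole window.\<close>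
        define R where "R = g ^ (l - min m l) * r 0"
        have R: "0 \<le> R" "R \<le> r 0"
          using g r0 by (auto simp: R_def power_le_one mult_left_le_one_le)
        have "norm (H (x (l - min m l + i)) - x (l - min m l + i)) \<le> R" if "i \<le> min m l" for i
        proof -
          have "r (l - min m l + i) \<le> g ^ (l - min m l + i) * r 0"
            using less[of "l - min m l + i"] that Suc by auto
          also have "\<dots> \<le> R" unfolding R_def
            by (intro mult_right_mono power_decreasing) (use g r0 in auto)
          finally show ?thesis by (simp add: r_def)
        qed
        moreover have "M * \<gamma> / (1 - \<gamma>) * R \<le> \<eta>"
          using mult_left_mono[OF R(2) C] Cr0 by (simp add: C_def)
        moreover have "norm (x j - p) \<le> \<eta>" if "j \<le> l" for j using less[of j] that Suc by simp
        moreover have "(\<Sum>i\<le>min m l. \<bar>\<alpha> l i\<bar>) \<le> M" using B[of l] by (simp add: M_def)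
        ultimately have step: "norm (x (Suc l) - p) \<le> C * R" "r (Suc l) \<le> \<gamma> * r l + Q * R\<^sup>2"
          using anderson_step[where k=l and B=M and R=R, OF it \<gamma> K lin contr\<eta> Abd quad\<eta>]
          unfolding C_def Q_def r_def by auto
        have "Q * R\<^sup>2 = (Q * r 0) * (g ^ (2 * (l - min m l)) * r 0)"
          by (simp add: R_def power2_eq_square power_mult_distrib mult_ac flip: power_add mult_2)
        also have "\<dots> \<le> ((g - \<gamma>) * g ^ (2 * m)) * (g ^ (2 * (l - min m l)) * r 0)"
          by (rule mult_right_mono[OF Qr0]) (use g r0 in simp)
        also have "\<dots> = (g - \<gamma>) * (g ^ (2 * m + 2 * (l - min m l)) * r 0)"
          by (simp add: power_add)
        \<comment> \<open>The exponent is \<open>2 * l\<close> if \<open>m \<le> l\<close> and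
          \<open>2 * m\<close> otherwise, in both cases at least \<open>l\<close>.\<close>
        also have "\<dots> \<le> (g - \<gamma>) * (g ^ l * r 0)"
          by (intro mult_left_mono mult_right_mono power_decreasing) (use g r0 in auto)
        finally have "Q * R\<^sup>2 \<le> (g - \<gamma>) * (g ^ l * r 0)" .
        moreover have "\<gamma> * r l \<le> \<gamma> * (g ^ l * r 0)"
          using less[of l] Suc \<gamma> by simp
        ultimately have "r (Suc l) \<le> g ^ Suc l * r 0"
          using step(2) by (simp add: algebra_simps)
        moreover have "norm (x (Suc l) - p) \<le> \<eta>"
          using step(1) mult_left_mono[OF R(2) C] Cr0 by linarith
        ultimately show ?thesis using Suc by simp
      qed
    qed
    \<comment> \<open>Bounding the initial residual by the initial error costs
      \<open>1 + \<gamma>\<close>; bounding the error at \<open>k\<close> by the residual at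
      \<open>k\<close> costs \<open>1 / (1 - \<gamma>)\<close>.\<close>
    have bd: "norm (x k - p) \<le> (1 + \<gamma>) / (1 - \<gamma>) * g ^ k * norm (x 0 - p)" for k
    proof -
      have "norm (x k - p) \<le> norm (H (x k) - p) + r k"
        using norm_triangle_ineq4[of "H (x k) - p" "H (x k) - x k"] by (simp add: r_def)
      also have "\<dots> \<le> \<gamma> * norm (x k - p) + g ^ k * ((1 + \<gamma>) * norm (x 0 - p))"
        using contr\<eta>[of "x k"] ind[of k] mult_left_mono[OF r0', of "g ^ k"] zero_le_power[of g k] g
        by linarith
      finally show ?thesis using \<gamma> by (simp add: field_simps)
    qed
    have "(\<lambda>k. (1 + \<gamma>) / (1 - \<gamma>) * g ^ k * norm (x 0 - p)) \<longlonglongrightarrow> (1 + \<gamma>) / (1 - \<gamma>) * 0 * norm (x 0 - p)"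
      by (intro tendsto_intros LIMSEQ_realpow_zero) (use g in auto)
    then have "(\<lambda>k. x k - p) \<longlonglongrightarrow> 0"
      by (intro Lim_null_comparison[OF always_eventually[OF allI[OF bd]]]) simp
    then show ?thesis using bd ind unfolding r_def by (simp add: LIM_zero_iff)
  qed
  show ?thesis using main \<delta> g by (intro exI[of _ \<delta>] conjI bexI[of _ g]) auto
qed

theorem theorem4p1:
  fixes f :: "real^'n::{finite,linorder} \<Rightarrow> real"
    and gs :: "'n \<Rightarrow> real \<Rightarrow> ereal"
    and g F :: "real^'n::{finite,linorder} \<Rightarrow> ereal"
    and H :: "real^'n::{finite,linorder} \<Rightarrow> real^'n::{finite,linorder}"
    and L\<^sub>f \<beta> :: real
    and xstar :: "real^'n::{finite,linorder}"
    and M :: "(real^'n::{finite,linorder}) set"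
  assumes g_eq: "g = (\<lambda>x. \<Sum>i\<in>UNIV. gs i (x $ i))"
    and F_eq: "F = (\<lambda>x. ereal (f x) + g x)"
    and F_closed: "closed_fun F"
    and F_level_bounded: "level_bounded F"
    and f_C2: "Ck_on 2 f UNIV"
    and f_convex: "convex_on UNIV f"
    and f_grad_lipschitz: "L\<^sub>f-lipschitz_on UNIV (grad f)"
    and gs_pcc: "\<And>i. proper_fun (gs i) \<and> closed_fun (gs i) \<and> convex_fun (gs i)"
    and beta: "\<beta> \<in> {0<..<inverse L\<^sub>f}"
    and H_eq: "H = prox_coord_sweep \<beta> f gs"
    and crit: "critical_point F xstar"
    and active: "active_manifold 3 g M xstar"
    and f_C4: "Ck_near 4 f xstar"
    and rint: "0 \<in> rel_interior (subdiff F xstar)"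
  shows
    "(Ck_near 2 H xstar \<and> lipschitz_near H xstar \<and> lipschitz_near (\<lambda>x. jacobian H (at x)) xstar) \<and>
     (\<forall>\<rho> \<gamma> M\<^sub>\<alpha> m.
        \<rho> > 0 \<and> \<gamma> \<in> {0<..<1} \<and>
        (\<forall>x\<in>cball xstar \<rho>. \<forall>y\<in>cball xstar \<rho>. norm (H x - H y) \<le> \<gamma> * norm (x - y)) \<and> m \<ge> 1 \<longrightarrow>
        (\<exists>\<delta>>0. \<exists>\<gamma>'\<in>{\<gamma><..<1}. \<forall>\<alpha> x.
           anderson_iteration H m \<alpha> x \<and>
           (\<forall>k. (\<Sum>i\<le>min m k. \<bar>\<alpha> k i\<bar>) \<le> M\<^sub>\<alpha>) \<and>
           norm (x 0 - xstar) \<le> \<delta> \<longrightarrow>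
           x \<longlonglongrightarrow> xstar \<and>
           (\<forall>k. norm (H (x k) - x k) \<le> \<gamma>' ^ k * norm (H (x 0) - x 0) \<and>
                norm (x k - xstar) \<le> (1 + \<gamma>) / (1 - \<gamma>) * \<gamma>' ^ k * norm (x 0 - xstar))))"
proof -
  have \<beta>: "\<beta> > 0" using beta by simp
  have conv: "convex_fun (gs i)" and ninf: "gs i t \<noteq> -\<infinity>" for i t
    using gs_pcc[of i] by (auto simp: proper_fun_def)
  have gconv: "convex_fun g" unfolding g_eq by (rule convex_fun_separable[OF conv ninf])
  have gninf: "g x \<noteq> -\<infinity>" for x unfolding g_eq using ninf by (intro sum_ereal_not_MInf)
  have "convex_fun F" unfolding F_eq
    by (rule convex_fun_add[OF convex_fun_of_convex_on[OF f_convex] gconv _ gninf]) simp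
  define d where "d = grad f xstar"
  have diff: "f differentiable (at xstar)" using f_C2 by (simp add: numeral_2_eq_2)
  have "frechet_derivative f (at xstar) = (\<lambda>v. d \<bullet> v)"
    using frechet_derivative_eq_grad[OF diff] by (auto simp: d_def)
  then have df: "(f has_derivative (\<lambda>v. d \<bullet> v)) (at xstar)"
    using iffD1[OF frechet_derivative_works diff] by simp
  \<comment> \<open>Adding \<open>f\<close> translates the subgradients of \<open>g\<close> by the
    gradient \<open>d\<close>, so criticality puts \<open>- d\<close> among the subgradients of
    \<open>g\<close>.\<close>
  have S: "s \<in> subdiff F xstar \<longleftrightarrow> s - d \<in> subgradients g xstar" for s
    using subgradients_add_smooth[OF f_convex df gconv, of s] subdiff_convex[OF \<open>convex_fun F\<close>]
    unfolding F_eq by simp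
  have "- d \<in> subgradients g xstar" using S[of 0] crit by (simp add: critical_point_def)
  then have di: "- d $ i \<in> subgradients (gs i) (xstar $ i)" for i
    using subgradients_separable[of gs "- d" xstar, OF ninf] unfolding g_eq by simp
  \<comment> \<open>The argument of the proximal map is a point plus \<beta> times one of its
    subgradients, the form in which its value is known.\<close>
  have arg: "xstar $ j - \<beta> * partial_deriv j f xstar = xstar $ j + \<beta> * (- d $ j)" for j
    by (simp add: d_def grad_def)
  have prox_Ck: "Ck_near 2 (prox \<beta> (gs j)) (xstar $ j - \<beta> * partial_deriv j f xstar)" for j
    unfolding arg
  proof (cases "j \<in> kinks gs xstar")
    case True
    obtain s1 s2 where s: "s1 \<in> subgradients (gs j) (xstar $ j)" "s2 \<in> subgradients (gs j) (xstar $ j)"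
      "s1 < - d $ j" "- d $ j < s2"
      using rel_interior_subgradients_kink[OF ninf S[unfolded g_eq] rint True] by blast
    have "\<forall>\<^sub>F z in nhds (xstar $ j + \<beta> * (- d $ j)). xstar $ j = prox \<beta> (gs j) z"
      using prox_locally_constant[OF \<beta> s] by eventually_elim simp
    moreover have "Ck_near 2 (\<lambda>z. xstar $ j) (xstar $ j + \<beta> * (- d $ j))"
      unfolding Ck_near_def by (intro exI[of _ UNIV] conjI Ck_on_const) auto
    ultimately show "Ck_near 2 (prox \<beta> (gs j)) (xstar $ j + \<beta> * (- d $ j))"
      by (rule Ck_near_cong[rotated])
  next
    case False
    then obtain s where "subgradients (gs j) (xstar $ j) = {s}" by (auto simp: kinks_def)
    then have sing: "subgradients (gs j) (xstar $ j) = {- d $ j}" using di[of j] by simp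
    obtain U h where Uh: "open U" "xstar $ j \<in> U" "Ck_on 3 h U" "\<forall>t\<in>U. gs j t = ereal (h t)"
      using active_manifold_smooth_coordinate[OF g_eq conv ninf active _ False] by auto
    have "Ck_on (Suc 2) h U" using Uh(3) by (simp add: numeral_3_eq_3 numeral_2_eq_2)
    from prox_smooth[OF \<beta> conv Uh(1,2) this _ _ sing] Uh(4)
    show "Ck_near 2 (prox \<beta> (gs j)) (xstar $ j + \<beta> * (- d $ j))" by simp
  qed
  \<comment> \<open>A coordinate step contains a first partial derivative of \<open>f\<close>, so
    order 3 of \<open>f\<close> yields order 2 of the step.\<close>
  have f_C3: "Ck_near (Suc 2) f xstar"
    using f_C4 Ck_on_le[of "Suc 2" 4 f] unfolding Ck_near_def by auto
  \<comment> \<open>Since \<open>- d $ i\<close> is a subgradient at \<open>xstar $ i\<close>, each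
    proximal map returns the coordinate it started from.\<close>
  have step_fix: "prox_coord_step \<beta> f gs j xstar = xstar" for j
    unfolding prox_coord_step_def
  proof (rule vec_eq_iff[THEN iffD2], rule allI)
    fix i
    have *: "prox \<beta> (gs i) (xstar $ i - \<beta> * partial_deriv i f xstar) = xstar $ i"
      unfolding arg using prox_subgradient[OF di \<beta>] by simp
    show "(\<chi> i. if i = j then prox \<beta> (gs i) (xstar $ i - \<beta> * partial_deriv i f xstar) else xstar $ i) $ i =
        xstar $ i" unfolding vec_lambda_beta * by simp
  qed
  have "Ck_near 2 (\<lambda>x. x) xstar"
    unfolding Ck_near_def by (intro exI[of _ UNIV] conjI Ck_on_bounded_linear bounded_linear_ident) auto
  from Ck_near_fold[where \<psi>="prox_coord_step \<beta> f gs" and js="sorted_list_of_set UNIV", OF this Ck_near_prox_coord_step[OF f_C3 prox_Ck] step_fix]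
  have H_C2: "Ck_near 2 H xstar" and H_fix: "H xstar = xstar"
    unfolding H_eq prox_coord_sweep_def by auto
  obtain U where U: "Ck_on 2 H U" "open U" "xstar \<in> U" using H_C2 by (auto simp: Ck_near_def)
  have U1: "Ck_on (Suc 0) H U" by (rule Ck_on_le[OF _ U(1)]) simp
  let ?A = "frechet_derivative H (at xstar)"
  have linA: "linear ?A" by (rule has_derivative_linear[OF Ck_on_has_derivative[OF U1 U(3)]])
  obtain e K where eK: "e > 0" "K \<ge> 0"
    and quad: "\<And>y. y \<in> ball xstar e \<Longrightarrow> norm (H y - xstar - ?A (y - xstar)) \<le> K * (norm (y - xstar))\<^sup>2"
    using Ck_on_2_quadratic_error[OF U] unfolding H_fix by blast
  show ?thesis
  proof (intro conjI allI impI)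
    show "Ck_near 2 H xstar" by (rule H_C2)
    show "lipschitz_near H xstar" by (rule Ck_on_1_lipschitz_near[OF U1 U(2,3)])
    show "lipschitz_near (\<lambda>x. jacobian H (at x)) xstar" by (rule Ck_on_2_jacobian_lipschitz_near[OF U])
  next
    fix \<rho> \<gamma> B :: real and m :: nat
    assume *: "\<rho> > 0 \<and> \<gamma> \<in> {0<..<1} \<and>
      (\<forall>x\<in>cball xstar \<rho>. \<forall>y\<in>cball xstar \<rho>. norm (H x - H y) \<le> \<gamma> * norm (x - y)) \<and> m \<ge> 1"
    then have "\<rho> > 0" "0 < \<gamma>" "\<gamma> < 1"
      "\<forall>x\<in>cball xstar \<rho>. \<forall>y\<in>cball xstar \<rho>. norm (H x - H y) \<le> \<gamma> * norm (x - y)" by auto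
    from anderson_local_convergence[OF this(1) eK(1) this(2,3) eK(2) linA H_fix this(4) quad]
    show "\<exists>\<delta>>0. \<exists>\<gamma>'\<in>{\<gamma><..<1}. \<forall>\<alpha> x.
           anderson_iteration H m \<alpha> x \<and>
           (\<forall>k. (\<Sum>i\<le>min m k. \<bar>\<alpha> k i\<bar>) \<le> B) \<and>
           norm (x 0 - xstar) \<le> \<delta> \<longrightarrow>
           x \<longlonglongrightarrow> xstar \<and>
           (\<forall>k. norm (H (x k) - x k) \<le> \<gamma>' ^ k * norm (H (x 0) - x 0) \<and>
                norm (x k - xstar) \<le> (1 + \<gamma>) / (1 - \<gamma>) * \<gamma>' ^ k * norm (x 0 - xstar))"
      by blast
  qed
qed

end
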